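(* Let $\mathcal{G}=(\mathcal{I},\mathcal{E})$ be an undirected graph with $\mathcal{I}=\{1,\dots,n\}$, and let $N_i$ be the set of neighbors of node $i$. Consider $n$ rigid bodies with attitudes $R_i(t)\in SO(3)$ and axis-angle representations $x_i\in\mathbb{R}^3$, $\hat x_i=\log(R_i)$, with kinematics $\dot x_i=L_{x_i}\omega_i$, where $\omega_i\in\mathbb{R}^3$ is the control input (angular velocity), under the controller $$\omega_i=\sum_{j\in N_i}\operatorname{sign}(x_j-x_i),\qquad i\in\mathcal{I},$$ with solutions of the closed loop $$\dot x_i=L_{x_i}\sum_{j\in N_i}\operatorname{sign}(x_j-x_i),\qquad i\in\mathcal{I},$$ understood in the sense of Filippov. Assume that $\mathcal{G}$ is connected and that the initial rotations satisfy $$\sum_{i=1}^n d_R^2(I,R_i(0))<\pi^2 .$$ Then the controller achieves attitude synchronization in finite time: for every Filippov solution $x=[x_1^\top,\dots,x_n^\top]^\top$ of the closed loop with this initial condition, there exist a time $t^*>0$ and a constant vector $\bar x\in\mathbb{R}^3$ such that $x(t)$ converges to $\mathds{1}\otimes\bar x$ as $t\to t^*$ and $x(t)=\mathds{1}\otimes\bar x$ for all $t\ge t^*$, where $\mathds{1}\in\mathbb{R}^n$ is the vector with all components equal to one.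
   Context: For $p=(p_1,p_2,p_3)^\top\in\mathbb{R}^3$, let $\hat p=\begin{pmatrix} 0 & -p_3 & p_2 \\ p_3 & 0 & -p_1 \\ -p_2 & p_1 & 0 \end{pmatrix}$. $SO(3)=\{R\in\mathbb{R}^{3\times3}: RR^\top=I,\ \det R=1\}$. For $R\in SO(3)$ with rotation angle $\theta=\arccos\big(\frac{\operatorname{trace}(R)-1}{2}\big)\in(0,\pi)$, $\log(R)=\frac{\theta}{2\sin\theta}(R-R^\top)$, and $\log(I)=0$. The Riemannian distance on $SO(3)$ is $d_R(R_1,R_2)=\frac{1}{\sqrt2}\|\log(R_1^{-1}R_2)\|_F$ with $\|\cdot\|_F$ the Frobenius norm (equal to the rotation angle of $R_1^{-1}R_2$; rotations of angle $\pi$ are at distance $\pi$ from $I$). Thus the open ball $B_\pi(I)\subset SO(3)$ is diffeomorphic to the open ball of radius $\pi$ centered at $0$ in $\mathbb{R}^3$ via $\hat x=\log(R)$, and $d_R(I,R)=\|x\|_2$ there. The function $\operatorname{sinc}$ is defined by $\alpha\operatorname{sinc}(\alpha)=\sin(\alpha)$ and $\operatorname{sinc}(0)=1$. For $y\in\mathbb{R}^3$ with $\|y\|_2<2\pi$, the transition matrix $L_y\in\mathbb{R}^{3\times3}$ is $$L_y=\frac{\operatorname{sinc}(\|y\|)}{\operatorname{sinc}^2(\|y\|/2)}I_3+\Big(1-\frac{\operatorname{sinc}(\|y\|)}{\operatorname{sinc}^2(\|y\|/2)}\Big)\frac{yy^\top}{\|y\|^2}+\frac{\hat y}{2},$$ with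 $L_0=I_3$ (the continuous extension at $y=0$). Here $\|\cdot\|=\|\cdot\|_2$ is the Euclidean norm. The scalar sign function is $\operatorname{sign}(a)=1$ if $a>0$, $0$ if $a=0$, $-1$ if $a<0$; for vectors it is applied componentwise. Filippov set-valued map: for a map $X$ with values in $\mathbb{R}^N$, $\mathcal{F}[X](x)=\bigcap_{\delta>0}\bigcap_{\mu(S)=0}\overline{\mathrm{co}}\{X(B(x,\delta)\setminus S)\}$, where $B(x,\delta)$ is the open ball of radius $\delta$ centered at $x$, $\mu$ is Lebesgue measure, and $\overline{\mathrm{co}}$ is the closed convex hull. A Filippov solution of $\dot x=X(x)$ on $[0,T]$ is an absolutely continuous function $x$ with $\dot x(t)\in\mathcal{F}[X](x(t))$ for almost all $t\in[0,T]$; solutions considered are maximal, i.e. cannot be extended forward in time. Here $X$ is the stacked right-hand side of the closed loop on $\mathbb{R}^{3n}$. *)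

theory Defs
  imports "HOL-Probability.Sinc_Integral"
begin

definition hat :: "real^3 \<Rightarrow> real^3^3" where
  "hat p = vector [vector [0, - (p$3), p$2],
                   vector [p$3, 0, - (p$1)],
                   vector [- (p$2), p$1, 0]]"

definition SO3 :: "(real^3^3) set" where
  "SO3 = {R. rotation_matrix R}"

definition rot_angle :: "real^3^3 \<Rightarrow> real" where
  "rot_angle R = arccos ((trace R - 1) / 2)"

text \<open>Only meaningful on rotations of angle less than \<open>pi\<close>; at angle \<open>pi\<close> the division by
  \<open>sin pi = 0\<close> yields the junk value \<open>0\<close>.\<close>

definition so3_log :: "real^3^3 \<Rightarrow> real^3^3" where
  "so3_log R = (if R = mat 1 then 0
     else (rot_angle R / (2 * sin (rot_angle R))) *\<^sub>R (R - transpose R))"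

text \<open>The norm of type \<^typ>\<open>real^3^3\<close> is the Frobenius norm. Relative rotations of angle
  \<open>pi\<close>, where the logarithm is not available, are treated separately: without the
  case distinction they would get distance \<open>0\<close>.\<close>

definition so3_dist :: "real^3^3 \<Rightarrow> real^3^3 \<Rightarrow> real" where
  "so3_dist R\<^sub>1 R\<^sub>2 =
     (let Q = matrix_inv R\<^sub>1 ** R\<^sub>2
      in if rot_angle Q = pi then pi else 1 / sqrt 2 * norm (so3_log Q))"

text \<open>Only meaningful for \<^term>\<open>norm y < 2 * pi\<close>.\<close>

definition transition_matrix :: "real^3 \<Rightarrow> real^3^3" where
  "transition_matrix y = (if y = 0 then mat 1
     else (let c = sinc (norm y) / (sinc (norm y / 2))\<^sup>2
           in c *\<^sub>R mat 1
              + ((1 - c) / (norm y)\<^sup>2) *\<^sub>R (\<chi> k l. y$k * y$l)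
              + (1 / 2) *\<^sub>R hat y))"


definition filippov :: "('a::euclidean_space \<Rightarrow> 'a) \<Rightarrow> 'a \<Rightarrow> 'a set" where
  "filippov X x = (\<Inter>\<delta>\<in>{0<..}. \<Inter>S\<in>null_sets lebesgue. closure (convex hull (X ` (ball x \<delta> - S))))"

text \<open>Each finite family of non-overlapping subintervals is represented by the set of pairs of
  their endpoints.\<close>

definition abs_continuous_on_interval ::
  "real \<Rightarrow> real \<Rightarrow> (real \<Rightarrow> 'a::real_normed_vector) \<Rightarrow> bool" where
  "abs_continuous_on_interval a b f \<longleftrightarrow>
     (\<forall>\<epsilon>>0. \<exists>\<delta>>0. \<forall>P. finite P \<and> (\<forall>(u, v)\<in>P. a \<le> u \<and> u \<le> v \<and> v \<le> b) \<and>
        pairwise (\<lambda>(u, v) (u', v'). disjnt {u<..<v} {u'<..<v'}) P \<and>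
        (\<Sum>(u, v)\<in>P. v - u) < \<delta> \<longrightarrow> (\<Sum>(u, v)\<in>P. norm (f v - f u)) < \<epsilon>)"

definition filippov_solution ::
  "('a::euclidean_space \<Rightarrow> 'a) \<Rightarrow> real \<Rightarrow> (real \<Rightarrow> 'a) \<Rightarrow> bool" where
  "filippov_solution X T x \<longleftrightarrow> abs_continuous_on_interval 0 T x \<and>
     (AE t in lebesgue_on {0..T}.
        \<exists>v\<in>filippov X (x t). (x has_vector_derivative v) (at t within {0..T}))"

text \<open>Time domains \<open>D\<close> are nondegenerate intervals of the form \<open>[0,T]\<close>, \<open>[0,T)\<close> or
  \<open>[0,\<infinity>)\<close>; values of \<open>x\<close> outside \<open>D\<close> are irrelevant.\<close>

definition filippov_solution_on ::
  "('a::euclidean_space \<Rightarrow> 'a) \<Rightarrow> real set \<Rightarrow> (real \<Rightarrow> 'a) \<Rightarrow> bool" where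
  "filippov_solution_on X D x \<longleftrightarrow>
     is_interval D \<and> 0 \<in> D \<and> D \<subseteq> {0..} \<and> D \<noteq> {0} \<and>
     (\<forall>T\<in>D. 0 < T \<longrightarrow> filippov_solution X T x)"

definition maximal_filippov_solution ::
  "('a::euclidean_space \<Rightarrow> 'a) \<Rightarrow> real set \<Rightarrow> (real \<Rightarrow> 'a) \<Rightarrow> bool" where
  "maximal_filippov_solution X D x \<longleftrightarrow> filippov_solution_on X D x \<and>
     \<not> (\<exists>D' y. D \<subset> D' \<and> filippov_solution_on X D' y \<and> (\<forall>t\<in>D. y t = x t))"


definition undirected_graph :: "'n set set \<Rightarrow> bool" where
  "undirected_graph E \<longleftrightarrow> (\<forall>e\<in>E. card e = 2)"

definition neighbours :: "'n set set \<Rightarrow> 'n \<Rightarrow> 'n set" where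
  "neighbours E i = {j. {i, j} \<in> E}"

definition connected_graph :: "'n set set \<Rightarrow> bool" where
  "connected_graph E \<longleftrightarrow> (\<forall>i j. (i, j) \<in> {(u, v). v \<in> neighbours E u}\<^sup>*)"

text \<open>Componentwise sign; the library function \<^const>\<open>sgn\<close> on vectors would normalise instead.\<close>

definition vsign :: "real^'k \<Rightarrow> real^'k" where
  "vsign v = (\<chi> k. sgn (v$k))"

definition controller :: "'n::finite set set \<Rightarrow> real^3^'n \<Rightarrow> 'n \<Rightarrow> real^3" where
  "controller E x i = (\<Sum>j\<in>neighbours E i. vsign (x$j - x$i))"

text \<open>The stacked right-hand side; the states in \<open>\<real>\<^sup>3\<^sup>n\<close> are the elements of
  \<^typ>\<open>real^3^'n\<close>, whose norm is the Euclidean one.\<close>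

definition closed_loop :: "'n::finite set set \<Rightarrow> real^3^'n \<Rightarrow> real^3^'n" where
  "closed_loop E x = (\<chi> i. transition_matrix (x$i) *v controller E x i)"

end

theory Submission
  imports Defs "HOL-Complex_Analysis.Great_Picard"
begin

text \<open>
  Two Lyapunov functions drive the result. Write \<open>L\<^sub>i\<close> for the transition matrix at \<open>x\<^sub>i\<close>. For the squared
  norm, \<open>L\<^sub>i\<close> acts like the identity in the direction of \<open>x\<^sub>i\<close>, so the sum of the \<open>\<parallel>x\<^sub>i\<parallel>\<^sup>2\<close> has
  derivative \<open>-2 V\<close>, where \<open>V\<close> is the sum of \<open>\<parallel>x\<^sub>j - x\<^sub>i\<parallel>\<^sub>1\<close> over the edges. Hence the state stays in the ball
  of radius \<open>\<parallel>x(0)\<parallel> < pi\<close>, on which all \<open>L\<^sub>i\<close> are uniformly positive definite: \<open>w \<bullet> L\<^sub>i w \<ge> \<gamma> \<parallel>w\<parallel>\<^sup>2\<close>.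

  The second function is \<open>V\<close> itself. It is convex, the stacked controller is the negative of a
  subgradient of \<open>V\<close>, and every velocity in the Filippov set has the form \<open>v\<^sub>i = L\<^sub>i \<omega>\<^sub>i\<close> with
  \<open>-\<omega>\<close> a subgradient of \<open>V\<close> at \<open>x\<close> (\<open>filippov_closed_loop_descent\<close>). At almost every time
  the derivative of \<open>V\<close> along the solution is then \<open>-\<omega> \<bullet> v \<le> -\<gamma> \<parallel>\<omega>\<parallel>\<^sup>2\<close>. Since \<open>V\<close> is positively homogeneous and invariant
  under common translations, and dominates all differences \<open>x\<^sub>j - x\<^sub>i\<close> when the graph is
  connected, subgradients at points with \<open>V > 0\<close> have norm at least some \<open>\<kappa> > 0\<close>. So \<open>V\<close>
  decreases at rate at least \<open>\<gamma> \<kappa>\<^sup>2\<close> until it vanishes, which happens in finite time. Afterwards all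
  \<open>x\<^sub>i\<close> coincide, and because the components of \<open>\<omega>\<close> sum to zero (translation invariance again), the
  common value no longer moves.

  The time domain of a maximal solution is the whole half-line because a solution in the ball is
  Lipschitz, hence extends to the end of a bounded domain, and can be continued from there by
  \<open>filippov_local_existence\<close>. That existence result takes uniform limits of Euler polygons, and it
  is the differentiability of Lipschitz functions almost everywhere that makes
  the limit a solution. The latter fact also gives the derivative of \<open>V\<close> along a solution, and the
  inequalities for derivatives are integrated by \<open>abs_continuous_upper_bound\<close>.
\<close>

section \<open>Lipschitz functions are differentiable almost everywhere\<close>

text \<open>Vitali's theorem speaks of closed balls. Slopes at a point \<open>x\<close> are measured
  over intervals that contain \<open>x\<close> anywhere, possibly as an endpoint, so the covering is
  needed in this form.\<close>

lemma vitali_covering_intervals: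
  fixes S :: "real set" and P :: "real \<Rightarrow> real \<Rightarrow> bool"
  assumes "\<forall>x\<in>S. \<forall>d>0. \<exists>u v. u < v \<and> u \<le> x \<and> x \<le> v \<and> v - u < d \<and> P u v"
  shows "\<exists>C. countable C \<and> (\<forall>(u, v)\<in>C. u < v \<and> P u v) \<and>
    disjoint_family_on (\<lambda>(u, v). {u..v}) C \<and> negligible (S - (\<Union>(u, v)\<in>C. {u..v}))"
proof -
  define K where "K = {(u, v). u < v \<and> P u v}"
  define m where "m = (\<lambda>(u, v). (u + v) / 2 :: real)"
  define r where "r = (\<lambda>(u, v). (v - u) / 2 :: real)"
  have ball: "cball (m i) (r i) = (case i of (u, v) \<Rightarrow> {u..v})" for i
    by (cases i) (auto simp: m_def r_def cball_eq_atLeastAtMost field_simps)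
  have cover: "\<exists>i. i \<in> K \<and> x \<in> cball (m i) (r i) \<and> r i < d" if x: "x \<in> S" "0 < d" for x d
  proof -
    obtain u v where "u < v" "u \<le> x" "x \<le> v" "v - u < d" "P u v"
      using assms x by blast
    then show ?thesis
      unfolding ball by (intro exI[of _ "(u, v)"]) (auto simp: K_def r_def)
  qed
  have pos: "0 < r i" if "i \<in> K" for i
    using that by (auto simp: K_def r_def)
  obtain C where C: "countable C" "C \<subseteq> K"
      "pairwise (\<lambda>i j. disjnt (cball (m i) (r i)) (cball (m j) (r j))) C"
      "negligible (S - (\<Union>i\<in>C. cball (m i) (r i)))"
    by (rule Vitali_covering_theorem_cballs[of K r S m, OF pos cover])
  show ?thesis
  proof (intro exI[of _ C] conjI)
    show "\<forall>(u, v)\<in>C. u < v \<and> P u v"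
      using C(2) by (auto simp: K_def)
    show "disjoint_family_on (\<lambda>(u, v). {u..v}) C"
      using C(3) unfolding ball by (auto simp: disjoint_family_on_def pairwise_def disjnt_def)
    show "negligible (S - (\<Union>(u, v)\<in>C. {u..v}))"
      using C(4) unfolding ball .
  qed (fact C(1))
qed

text \<open>In terms of derivates over intervals that contain \<open>x\<close>, this holds if the
  lower derivate is less than \<open>p\<close>, and implies that it is at most
  \<open>p\<close>.\<close>

definition slope_below :: "(real \<Rightarrow> real) \<Rightarrow> real \<Rightarrow> real \<Rightarrow> bool" where
  "slope_below g p x \<longleftrightarrow>
     (\<forall>d>0. \<exists>u v. u < v \<and> u \<le> x \<and> x \<le> v \<and> v - u < d \<and> g v - g u \<le> p * (v - u))"

definition slope_above :: "(real \<Rightarrow> real) \<Rightarrow> real \<Rightarrow> real \<Rightarrow> bool" where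
  "slope_above g q x \<longleftrightarrow>
     (\<forall>d>0. \<exists>u v. u < v \<and> u \<le> x \<and> x \<le> v \<and> v - u < d \<and> q * (v - u) \<le> g v - g u)"

text \<open>Cover \<open>S\<close> by small intervals of mean slope at most \<open>p\<close> inside
  \<open>U\<close>, and then cover what remains of \<open>S\<close> in their interiors by intervals
  of mean slope at least \<open>q\<close>. Measuring the second family \<open>B\<close> by the
  Stieltjes measure of \<open>g\<close> gives at least \<open>q\<close> times its length, while the
  first family contains it and has Stieltjes measure at most \<open>p\<close> times its own
  length.\<close>

lemma slope_gap_shrink:
  fixes g :: "real \<Rightarrow> real"
  assumes mono: "\<And>x y. x \<le> y \<Longrightarrow> g x \<le> g y" and cont: "continuous_on UNIV g"
    and p: "0 \<le> p" and q: "0 \<le> q"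
    and S: "\<And>x. x \<in> S \<Longrightarrow> slope_below g p x" "\<And>x. x \<in> S \<Longrightarrow> slope_above g q x"
    and U: "open U" "S \<subseteq> U"
  obtains B where "B \<in> sets borel" "negligible (S - B)" "B \<subseteq> U"
    "ennreal q * emeasure lborel B \<le> ennreal p * emeasure lborel U"
proof -
  let ?\<nu> = "interval_measure g"
  let ?I = "\<lambda>(u, v). {u..v :: real}"
  have nu: "emeasure ?\<nu> {u..v} = ennreal (g v - g u)" if "u \<le> v" for u v
    using emeasure_interval_measure_Icc[OF that mono cont] .
  have local: "\<exists>u v. u < v \<and> u \<le> x \<and> x \<le> v \<and> v - u < d \<and> {u..v} \<subseteq> W \<and> Q u v"
    if W: "open W" "x \<in> W" and "0 < d"
      and Q: "\<And>d. 0 < d \<Longrightarrow> \<exists>u v. u < v \<and> u \<le> x \<and> x \<le> v \<and> v - u < d \<and> Q u v"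
    for W x d and Q :: "real \<Rightarrow> real \<Rightarrow> bool"
  proof -
    obtain e where e: "e > 0" "ball x e \<subseteq> W"
      by (rule openE[OF W])
    obtain u v where uv: "u < v" "u \<le> x" "x \<le> v" "v - u < min d e" "Q u v"
      using Q[of "min d e"] e \<open>0 < d\<close> by auto
    then have "{u..v} \<subseteq> ball x e"
      by (auto simp: dist_real_def)
    then have "{u..v} \<subseteq> W" "v - u < d"
      using e uv by auto
    with uv show ?thesis by blast
  qed
  have "\<forall>x\<in>S. \<forall>d>0. \<exists>u v. u < v \<and> u \<le> x \<and> x \<le> v \<and> v - u < d \<and>
      {u..v} \<subseteq> U \<and> g v - g u \<le> p * (v - u)"
    using U S(1)[unfolded slope_below_def] by (intro ballI allI impI local) auto
  from vitali_covering_intervals[of S "\<lambda>u v. {u..v} \<subseteq> U \<and> g v - g u \<le> p * (v - u)", OF this]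
  obtain C where C: "countable C" "disjoint_family_on ?I C" "negligible (S - (\<Union>(u, v)\<in>C. {u..v}))"
      and C': "\<And>u v. (u, v) \<in> C \<Longrightarrow> u < v \<and> {u..v} \<subseteq> U \<and> g v - g u \<le> p * (v - u)"
    by (elim exE conjE) (rule that, auto)
  define W where "W = (\<Union>(u, v)\<in>C. {u<..<v})"
  have "open W"
    by (auto simp: W_def)
  then have "\<forall>x\<in>S \<inter> W. \<forall>d>0. \<exists>u v. u < v \<and> u \<le> x \<and> x \<le> v \<and> v - u < d \<and>
      {u..v} \<subseteq> W \<and> q * (v - u) \<le> g v - g u"
    using S(2)[unfolded slope_above_def] by (intro ballI allI impI local) auto
  from vitali_covering_intervals[of "S \<inter> W" "\<lambda>u v. {u..v} \<subseteq> W \<and> q * (v - u) \<le> g v - g u", OF this]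
  obtain D where D: "countable D" "disjoint_family_on ?I D"
        "negligible (S \<inter> W - (\<Union>(u, v)\<in>D. {u..v}))"
      and D': "\<And>u v. (u, v) \<in> D \<Longrightarrow> u < v \<and> {u..v} \<subseteq> W \<and> q * (v - u) \<le> g v - g u"
    by (elim exE conjE) (rule that, auto)
  define A B where "A = (\<Union>(u, v)\<in>C. {u..v})" and "B = (\<Union>(u, v)\<in>D. {u..v})"
  have AB [measurable]: "A \<in> sets borel" "B \<in> sets borel"
    unfolding A_def B_def using C(1) D(1) by (auto intro!: sets.countable_UN'')
  have "A \<subseteq> U"
    using C' unfolding A_def by auto
  have "B \<subseteq> W"
    using D' unfolding B_def by auto
  also have "W \<subseteq> A"
    unfolding W_def A_def by (intro UN_mono) auto
  finally have "B \<subseteq> A" .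
  have union: "emeasure M (\<Union>(u, v)\<in>K. {u..v}) = (\<integral>\<^sup>+i. emeasure M (?I i) \<partial>count_space K)"
    if "sets M = sets borel" "countable K" "disjoint_family_on ?I K" for M :: "real measure" and K
    using emeasure_UN_countable[of K ?I M] that by (auto simp: case_prod_unfold)
  have "ennreal q * emeasure lborel B = (\<integral>\<^sup>+i. ennreal q * emeasure lborel (?I i) \<partial>count_space D)"
    unfolding B_def using D by (subst union) (auto simp: nn_integral_cmult)
  also have "\<dots> \<le> (\<integral>\<^sup>+i. emeasure ?\<nu> (?I i) \<partial>count_space D)"
    using D' q
    by (intro nn_integral_mono) (auto simp: nu less_imp_le ennreal_mult[symmetric] intro!: ennreal_leI)
  also have "\<dots> = emeasure ?\<nu> B"
    unfolding B_def using D by (subst union) auto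
  also have "\<dots> \<le> emeasure ?\<nu> A"
    using \<open>B \<subseteq> A\<close> by (intro emeasure_mono) auto
  also have "\<dots> = (\<integral>\<^sup>+i. emeasure ?\<nu> (?I i) \<partial>count_space C)"
    unfolding A_def using C by (subst union) auto
  also have "\<dots> \<le> (\<integral>\<^sup>+i. ennreal p * emeasure lborel (?I i) \<partial>count_space C)"
    using C' p
    by (intro nn_integral_mono) (auto simp: nu less_imp_le ennreal_mult[symmetric] intro!: ennreal_leI)
  also have "\<dots> = ennreal p * emeasure lborel A"
    unfolding A_def using C by (subst union) (auto simp: nn_integral_cmult)
  also have "\<dots> \<le> ennreal p * emeasure lborel U"
    using \<open>A \<subseteq> U\<close> U by (intro mult_left_mono emeasure_mono) auto
  finally have "ennreal q * emeasure lborel B \<le> ennreal p * emeasure lborel U" .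
  moreover have "negligible (S - B)"
  proof (rule negligible_subset)
    \<comment> \<open>only the endpoints of the first family are lost when passing to its
      interiors\<close>
    have "countable (fst ` C \<union> snd ` C)"
      using C(1) by simp
    then have "negligible (fst ` C \<union> snd ` C)"
      unfolding negligible_iff_null_sets by (intro null_sets_completionI countable_imp_null_set_lborel)
    from negligible_Un[OF negligible_Un[OF C(3) this] D(3)]
    show "negligible ((S - A) \<union> (fst ` C \<union> snd ` C) \<union> (S \<inter> W - B))"
      unfolding A_def B_def .
    show "S - B \<subseteq> (S - A) \<union> (fst ` C \<union> snd ` C) \<union> (S \<inter> W - B)"
    proof
      fix x assume x: "x \<in> S - B"
      have "x \<in> W \<or> x \<in> fst ` C \<or> x \<in> snd ` C" if xA: "x \<in> A"
      proof -
        obtain u v where "(u, v) \<in> C" "u \<le> x" "x \<le> v"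
          using xA by (auto simp: A_def)
        then show ?thesis
          unfolding W_def by (cases "x = u"; cases "x = v") force+
      qed
      with x show "x \<in> (S - A) \<union> (fst ` C \<union> snd ` C) \<union> (S \<inter> W - B)" by blast
    qed
  qed
  ultimately show thesis
    using that \<open>B \<subseteq> A\<close> \<open>A \<subseteq> U\<close> AB by blast
qed

text \<open>Applied to open sets \<open>U\<close> whose measure approaches the outer measure
  \<open>e\<close> of a bounded part of the set, \<open>slope_gap_shrink\<close> yields \<open>q e
  \<le> p e\<close>, which forces \<open>e = 0\<close>.\<close>

lemma negligible_slope_gap:
  fixes g :: "real \<Rightarrow> real"
  assumes mono: "\<And>x y. x \<le> y \<Longrightarrow> g x \<le> g y" and cont: "continuous_on UNIV g"
    and pq: "0 \<le> p" "p < q"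
  shows "negligible {x. slope_below g p x \<and> slope_above g q x}"
proof -
  let ?E = "{x. slope_below g p x \<and> slope_above g q x}"
  have bounded_part: "negligible (?E \<inter> {-R<..<R})" for R :: real
  proof -
    define S where "S = ?E \<inter> {-R<..<R}"
    define \<U> where "\<U> = {U. open U \<and> S \<subseteq> U \<and> U \<in> lmeasurable}"
    define e where "e = Inf (measure lebesgue ` \<U>)"
    have ne: "\<U> \<noteq> {}"
    proof -
      have "{-R<..<R} \<in> \<U>"
        by (auto simp: \<U>_def S_def)
      then show ?thesis by blast
    qed
    have bdd: "bdd_below (measure lebesgue ` \<U>)"
      by (rule bdd_belowI[of _ 0]) auto
    have "e \<ge> 0"
      unfolding e_def using ne by (intro cInf_greatest) auto
    have gap: "(q - p) * e \<le> (p + q) * \<epsilon>" if \<epsilon>: "\<epsilon> > 0" for \<epsilon>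
    proof -
      obtain U where U: "U \<in> \<U>" "measure lebesgue U < e + \<epsilon>"
        using cInf_lessD[of "measure lebesgue ` \<U>" "e + \<epsilon>"] ne \<epsilon> by (auto simp: e_def)
      have oU: "open U" "S \<subseteq> U" and mU: "U \<in> lmeasurable"
        using U by (auto simp: \<U>_def)
      obtain B where B: "B \<in> sets borel" "negligible (S - B)" "B \<subseteq> U"
          "ennreal q * emeasure lborel B \<le> ennreal p * emeasure lborel U"
      proof (rule slope_gap_shrink[OF mono cont pq(1) _ _ _ oU])
        show "0 \<le> q" using pq by simp
        show "slope_below g p x" "slope_above g q x" if "x \<in> S" for x
          using that by (auto simp: S_def)
      qed
      have mB: "B \<in> lmeasurable"
        using fmeasurableI2[OF mU B(3)] B(1) by simp
      have "emeasure lborel X = ennreal (measure lebesgue X)"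
        if "X \<in> sets borel" "X \<in> lmeasurable" for X :: "real set"
        using emeasure_eq_measure2[OF that(2)] that(1) emeasure_completion[of X lborel] by simp
      from this[of B] this[of U]
      have "ennreal (q * measure lebesgue B) \<le> ennreal (p * measure lebesgue U)"
        using B(1,4) mB mU oU(1) pq ennreal_mult[of q] ennreal_mult[of p] by auto
      then have qB: "q * measure lebesgue B \<le> p * measure lebesgue U"
        using pq by (simp add: ennreal_le_iff)
      define T where "T = B \<union> (S - B)"
      have T: "T \<in> lmeasurable"
        unfolding T_def by (rule fmeasurable.Un[OF mB negligible_imp_measurable[OF B(2)]])
      have mT: "measure lebesgue T = measure lebesgue B"
        unfolding T_def using B(2) mB
        by (intro measure_Un_null_set) (auto simp: negligible_iff_null_sets fmeasurableD)
      obtain V where V: "open V" "T \<subseteq> V" "V - T \<in> lmeasurable" "emeasure lebesgue (V - T) < ennreal \<epsilon>"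
        by (rule sets_lebesgue_outer_open[OF fmeasurableD[OF T] \<epsilon>])
      have mV: "V \<in> lmeasurable"
        using fmeasurable.Un[OF T V(3)] V(2) by (simp add: Un_absorb1)
      have "measure lebesgue V = measure lebesgue T + measure lebesgue (V - T)"
        using measurable_measure_Diff[OF mV fmeasurableD[OF T] V(2)] by simp
      also have "measure lebesgue (V - T) \<le> \<epsilon>"
        using V(3,4) \<epsilon> by (simp add: emeasure_eq_measure2 ennreal_less_iff)
      finally have "measure lebesgue V \<le> measure lebesgue B + \<epsilon>"
        using mT by simp
      moreover have "V \<in> \<U>"
        using V mV by (auto simp: \<U>_def T_def)
      then have "e \<le> measure lebesgue V"
        unfolding e_def using bdd by (intro cInf_lower) auto
      ultimately have "q * e \<le> q * (measure lebesgue B + \<epsilon>)"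
        using pq by (intro mult_left_mono) auto
      also have "\<dots> \<le> p * (e + \<epsilon>) + q * \<epsilon>"
        using qB mult_left_mono[OF less_imp_le[OF U(2)] pq(1)] by (simp add: algebra_simps)
      finally show ?thesis
        by (simp add: algebra_simps)
    qed
    have "(q - p) * e \<le> 0"
    proof (rule field_le_epsilon)
      fix d :: real assume "0 < d"
      moreover have "p + q \<noteq> 0" "0 < p + q"
        using pq by auto
      ultimately show "(q - p) * e \<le> 0 + d"
        using gap[of "d / (p + q)"] nonzero_mult_div_cancel_left[of "p + q" d] by simp
    qed
    then have "e \<le> 0"
      using pq by (simp add: mult_le_0_iff)
    show ?thesis
      unfolding S_def[symmetric] negligible_outer
    proof (intro allI impI)
      fix \<epsilon> :: real assume "\<epsilon> > 0"
      then obtain U where "U \<in> \<U>" "measure lebesgue U < \<epsilon>"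
        using cInf_lessD[of "measure lebesgue ` \<U>" \<epsilon>] ne \<open>e \<le> 0\<close> by (auto simp: e_def)
      then show "\<exists>T. S \<subseteq> T \<and> T \<in> lmeasurable \<and> measure lebesgue T < \<epsilon>"
        by (auto simp: \<U>_def)
    qed
  qed
  have "negligible (\<Union>n::nat. ?E \<inter> {- real n<..<real n})"
    by (intro negligible_countable_Union) (auto intro: bounded_part)
  moreover have "?E \<subseteq> (\<Union>n::nat. ?E \<inter> {- real n<..<real n})"
  proof
    fix x assume "x \<in> ?E"
    moreover obtain n :: nat where "\<bar>x\<bar> < real n"
      using reals_Archimedean2 by blast
    ultimately show "x \<in> (\<Union>n::nat. ?E \<inter> {- real n<..<real n})"
      by (auto intro!: exI[of _ n])
  qed
  ultimately show ?thesis
    by (rule negligible_subset)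
qed

text \<open>Adding \<open>L * x\<close> makes the function nondecreasing with slopes between
  \<open>0\<close> and \<open>2 * L\<close>. Where the derivative fails to exist, two rational
  slopes separate the lower from the upper derivate, so the exceptional points lie in countably many
  null sets.\<close>

lemma lipschitz_real_differentiable_ae_UNIV:
  fixes f :: "real \<Rightarrow> real"
  assumes f: "L-lipschitz_on UNIV f"
  shows "negligible {x. \<nexists>D. (f has_real_derivative D) (at x)}"
proof -
  define g where "g x = f x + L * x" for x
  have L: "0 \<le> L"
    using f by (rule lipschitz_on_nonneg)
  have f_le: "\<bar>f y - f x\<bar> \<le> L * (y - x)" if "x \<le> y" for x y
    using lipschitz_on_normD[OF f, of y x] that by (simp add: abs_if split: if_splits)
  have slope: "0 \<le> g y - g x" "g y - g x \<le> 2 * L * (y - x)" if "x \<le> y" for x y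
    using f_le[OF that] by (auto simp: g_def algebra_simps abs_le_iff)
  have mono: "g x \<le> g y" if "x \<le> y" for x y
    using slope[OF that] by simp
  have cont: "continuous_on UNIV g"
    unfolding g_def by (intro continuous_intros lipschitz_on_continuous_on[OF f])
  let ?E = "\<lambda>(p, q). {x. slope_below g p x \<and> slope_above g q x}"
  have "negligible (\<Union>r\<in>{(p, q) \<in> \<rat> \<times> \<rat>. 0 \<le> p \<and> p < q}. ?E r)"
  proof (rule negligible_countable_Union)
    have "countable {(p, q) \<in> \<rat> \<times> (\<rat> :: real set). 0 \<le> p \<and> p < q}"
      by (rule countable_subset[of _ "\<rat> \<times> \<rat>"]) (auto intro: countable_SIGMA countable_rat)
    then show "countable (?E ` {(p, q) \<in> \<rat> \<times> \<rat>. 0 \<le> p \<and> p < q})"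
      by (rule countable_image)
  qed (use negligible_slope_gap[OF mono cont] in auto)
  moreover have "\<exists>D. (f has_real_derivative D) (at x)"
    if gap: "\<forall>p\<in>\<rat>. \<forall>q\<in>\<rat>. 0 \<le> p \<longrightarrow> p < q \<longrightarrow> \<not> (slope_below g p x \<and> slope_above g q x)" for x
  proof -
    \<comment> \<open>the lower derivate of \<open>g\<close> at \<open>x\<close>, which turns out to
      be the derivative\<close>
    define l where "l = Inf {p. slope_below g p x}"
    have below: "0 \<le> p" if "slope_below g p x" for p
    proof -
      obtain u v where "u < v" "g v - g u \<le> p * (v - u)"
        using \<open>slope_below g p x\<close> unfolding slope_below_def by (meson zero_less_one)
      then have "0 \<le> p * (v - u)" "0 < v - u"
        using slope(1)[of u v] by auto
      then show ?thesis
        by (simp add: zero_le_mult_iff)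
    qed
    have ne: "slope_below g (2 * L) x"
      unfolding slope_below_def
    proof (intro allI impI)
      fix d :: real assume "0 < d"
      then show "\<exists>u v. u < v \<and> u \<le> x \<and> x \<le> v \<and> v - u < d \<and> g v - g u \<le> 2 * L * (v - u)"
        using slope(2)[of x "x + d / 2"] by (intro exI[of _ x] exI[of _ "x + d / 2"]) auto
    qed
    have bdd: "bdd_below {p. slope_below g p x}"
      using below by (auto intro!: bdd_belowI[of _ 0])
    have near: "\<exists>d>0. \<forall>u v. u < v \<and> u \<le> x \<and> x \<le> v \<and> v - u < d \<longrightarrow>
        \<bar>(g v - g u) - l * (v - u)\<bar> \<le> \<epsilon> * (v - u)" if "\<epsilon> > 0" for \<epsilon>
    proof -
      obtain r where r: "r \<in> \<rat>" "l < r" "r < l + \<epsilon> / 2"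
        using Rats_dense_in_real[of l "l + \<epsilon> / 2"] \<open>\<epsilon> > 0\<close> by auto
      obtain q where q: "q \<in> \<rat>" "r < q" "q < l + \<epsilon>"
        using Rats_dense_in_real[of r "l + \<epsilon>"] \<open>\<epsilon> > 0\<close> r by auto
      obtain p where p: "slope_below g p x" "p < r"
        using cInf_lessD[of "{p. slope_below g p x}" r] ne r(2) unfolding l_def by auto
      have "slope_below g r x"
        unfolding slope_below_def
      proof (intro allI impI)
        fix d :: real assume "0 < d"
        then obtain u v where uv: "u < v" "u \<le> x" "x \<le> v" "v - u < d" "g v - g u \<le> p * (v - u)"
          using p(1) unfolding slope_below_def by blast
        moreover have "p * (v - u) \<le> r * (v - u)"
          using uv(1) p(2) by (intro mult_right_mono) auto
        ultimately show "\<exists>u v. u < v \<and> u \<le> x \<and> x \<le> v \<and> v - u < d \<and> g v - g u \<le> r * (v - u)"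
          by (meson order_trans)
      qed
      then have "\<not> slope_above g q x"
        using gap r q below by blast
      then obtain d1 where d1: "0 < d1" "\<And>u v. \<lbrakk>u < v; u \<le> x; x \<le> v; v - u < d1\<rbrakk> \<Longrightarrow> g v - g u < q * (v - u)"
        unfolding slope_above_def by (meson not_le)
      have "\<not> slope_below g (l - \<epsilon>) x"
      proof
        assume "slope_below g (l - \<epsilon>) x"
        then have "l \<le> l - \<epsilon>"
          unfolding l_def using bdd by (intro cInf_lower) auto
        then show False using \<open>\<epsilon> > 0\<close> by simp
      qed
      then obtain d2 where d2: "0 < d2" "\<And>u v. \<lbrakk>u < v; u \<le> x; x \<le> v; v - u < d2\<rbrakk> \<Longrightarrow> (l - \<epsilon>) * (v - u) < g v - g u"
        unfolding slope_below_def by (meson not_le)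
      show ?thesis
      proof (intro exI[of _ "min d1 d2"] conjI allI impI)
        fix u v assume uv: "u < v \<and> u \<le> x \<and> x \<le> v \<and> v - u < min d1 d2"
        then have "q * (v - u) \<le> (l + \<epsilon>) * (v - u)"
          using q(3) by (intro mult_right_mono) auto
        then show "\<bar>(g v - g u) - l * (v - u)\<bar> \<le> \<epsilon> * (v - u)"
          using d1(2)[of u v] d2(2)[of u v] uv by (simp add: algebra_simps abs_le_iff)
      qed (use d1 d2 in auto)
    qed
    have "(g has_real_derivative l) (at x)"
      unfolding has_field_derivative_def has_derivative_at_alt
    proof (intro conjI allI impI)
      fix e :: real assume "0 < e"
      from near[OF this] obtain d where d: "d > 0"
        "\<And>u v. \<lbrakk>u < v; u \<le> x; x \<le> v; v - u < d\<rbrakk> \<Longrightarrow> \<bar>(g v - g u) - l * (v - u)\<bar> \<le> e * (v - u)"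
        by blast
      show "\<exists>d>0. \<forall>y. norm (y - x) < d \<longrightarrow> norm (g y - g x - l * (y - x)) \<le> e * norm (y - x)"
      proof (intro exI[of _ d] conjI allI impI)
        fix y assume y: "norm (y - x) < d"
        consider "y < x" | "y = x" | "x < y" by linarith
        then show "norm (g y - g x - l * (y - x)) \<le> e * norm (y - x)"
        proof cases
          case 1
          then show ?thesis
            using d(2)[of y x] y by (simp add: abs_le_iff algebra_simps)
        next
          case 3
          then show ?thesis
            using d(2)[of x y] y by simp
        qed simp
      qed (fact d(1))
    qed (simp add: bounded_linear_mult_right)
    then have "((\<lambda>x. g x - L * x) has_real_derivative (l - L)) (at x)"
      by (auto intro!: derivative_eq_intros)
    then show ?thesis
      by (auto simp: g_def)
  qed
  ultimately show ?thesis
    by (elim negligible_subset) fast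
qed

text \<open>Freezing the function outside the interval reduces this to functions on the whole
  line.\<close>

lemma lipschitz_real_differentiable_ae:
  fixes f :: "real \<Rightarrow> real"
  assumes f: "L-lipschitz_on {a..b} f"
  shows "negligible {t \<in> {a..b}. \<nexists>D. (f has_real_derivative D) (at t within {a..b})}"
proof (cases "a \<le> b")
  case True
  define c where "c t = max a (min t b)" for t
  have "L-lipschitz_on UNIV (\<lambda>t. f (c t))"
  proof (rule lipschitz_onI)
    fix s t :: real
    have "dist (f (c s)) (f (c t)) \<le> L * dist (c s) (c t)"
      using True by (intro lipschitz_onD[OF f]) (auto simp: c_def)
    also have "\<dots> \<le> L * dist s t"
      using lipschitz_on_nonneg[OF f] by (intro mult_left_mono) (auto simp: c_def dist_real_def)
    finally show "dist (f (c s)) (f (c t)) \<le> L * dist s t" .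
  qed (rule lipschitz_on_nonneg[OF f])
  then have "negligible {t. \<nexists>D. ((\<lambda>t. f (c t)) has_real_derivative D) (at t)}"
    by (rule lipschitz_real_differentiable_ae_UNIV)
  moreover have "(f has_real_derivative D) (at t within {a..b})"
    if "((\<lambda>t. f (c t)) has_real_derivative D) (at t)" "t \<in> {a..b}" for D t
    by (rule has_field_derivative_transform_within[OF DERIV_subset[OF that(1)], of _ 1])
      (use that(2) in \<open>auto simp: c_def\<close>)
  ultimately show ?thesis
    by (elim negligible_subset) auto
qed auto

lemma lipschitz_differentiable_ae:
  fixes x :: "real \<Rightarrow> 'a::euclidean_space"
  assumes x: "L-lipschitz_on {a..b} x"
  shows "negligible {t \<in> {a..b}. \<nexists>v. (x has_vector_derivative v) (at t within {a..b})}"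
proof -
  let ?N = "\<lambda>i. {t \<in> {a..b}. \<nexists>D. ((\<lambda>t. x t \<bullet> i) has_real_derivative D) (at t within {a..b})}"
  have "negligible (\<Union>i\<in>Basis. ?N i)"
  proof (rule negligible_Union)
    fix S assume "S \<in> ?N ` Basis"
    then obtain i :: 'a where i: "i \<in> Basis" "S = ?N i" by blast
    have "L-lipschitz_on {a..b} (\<lambda>t. x t \<bullet> i)"
    proof (rule lipschitz_onI)
      fix s t assume "s \<in> {a..b}" "t \<in> {a..b}"
      then have "dist (x s) (x t) \<le> L * dist s t"
        by (rule lipschitz_onD[OF x])
      moreover have "dist (x s \<bullet> i) (x t \<bullet> i) \<le> dist (x s) (x t)"
        using Basis_le_norm[OF i(1), of "x s - x t"] by (simp add: dist_norm inner_diff_left)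
      ultimately show "dist (x s \<bullet> i) (x t \<bullet> i) \<le> L * dist s t" by simp
    qed (rule lipschitz_on_nonneg[OF x])
    then show "negligible S"
      unfolding i(2) by (rule lipschitz_real_differentiable_ae)
  qed simp
  moreover have "\<exists>v. (x has_vector_derivative v) (at t within {a..b})"
    if "t \<notin> (\<Union>i\<in>Basis. ?N i)" "t \<in> {a..b}" for t
  proof -
    have "\<forall>i\<in>Basis. \<exists>D. ((\<lambda>t. x t \<bullet> i) has_real_derivative D) (at t within {a..b})"
      using that by blast
    then obtain D where D: "\<And>i. i \<in> Basis \<Longrightarrow> ((\<lambda>t. x t \<bullet> i) has_real_derivative D i) (at t within {a..b})"
      by metis
    have "((\<lambda>t. \<Sum>i\<in>Basis. (x t \<bullet> i) *\<^sub>R i) has_vector_derivative (\<Sum>i\<in>Basis. D i *\<^sub>R i)) (at t within {a..b})"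
      using D by (intro has_vector_derivative_sum) (auto intro!: derivative_eq_intros)
    then show ?thesis
      by (auto simp: euclidean_representation)
  qed
  ultimately show ?thesis
    by (elim negligible_subset) blast
qed

section \<open>Absolutely continuous functions\<close>

text \<open>This replaces the fundamental theorem of calculus for absolutely continuous functions.
  Choose an open set \<open>U\<close> of small measure around the exceptional set \<open>N\<close>,
  and a gauge that confines intervals tagged in \<open>N\<close> to \<open>U\<close> and controls
  the slope of all others. In a fine tagged division, the intervals of the first kind contribute
  little by absolute continuity, and those of the second kind at most \<open>K + \<epsilon>\<close>
  times their length.\<close>

lemma abs_continuous_upper_bound:
  fixes f :: "real \<Rightarrow> real"
  assumes ac: "abs_continuous_on_interval a b f" and ab: "a \<le> b" and N: "negligible N"
    and deriv: "\<And>t. t \<in> {a..b} - N \<Longrightarrow> \<exists>d\<le>K. (f has_real_derivative d) (at t within {a..b})"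
  shows "f b - f a \<le> K * (b - a)"
proof (rule field_le_epsilon)
  fix e :: real assume "0 < e"
  \<comment> \<open>the total error is \<open>\<epsilon>\<close> times the length, plus
    \<open>\<epsilon>\<close> from the increments over \<open>N\<close>, plus
    \<open>\<epsilon>\<close> because the lengths of those intervals are missing from the main
    part\<close>
  define \<epsilon> where "\<epsilon> = e / (b - a + 2)"
  have "0 < \<epsilon>"
    using \<open>0 < e\<close> ab by (auto simp: \<epsilon>_def)
  obtain \<delta> where \<delta>: "\<delta> > 0"
    and small: "\<And>P. \<lbrakk>finite P; \<forall>(u, v)\<in>P. a \<le> u \<and> u \<le> v \<and> v \<le> b;
        pairwise (\<lambda>(u, v) (u', v'). disjnt {u<..<v} {u'<..<v'}) P; (\<Sum>(u, v)\<in>P. v - u) < \<delta>\<rbrakk>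
      \<Longrightarrow> (\<Sum>(u, v)\<in>P. norm (f v - f u)) < \<epsilon>"
    using ac \<open>0 < \<epsilon>\<close> unfolding abs_continuous_on_interval_def by meson
  define \<eta> where "\<eta> = min \<delta> (\<epsilon> / (\<bar>K\<bar> + 1))"
  have "0 < \<eta>"
    using \<delta> \<open>0 < \<epsilon>\<close> by (auto simp: \<eta>_def)
  obtain U where U: "open U" "N \<subseteq> U" "U \<in> lmeasurable" "measure lebesgue U < \<eta>"
  proof -
    obtain U where "open U" "N \<subseteq> U" "U - N \<in> lmeasurable" "emeasure lebesgue (U - N) < ennreal \<eta>"
      by (rule sets_lebesgue_outer_open[OF negligible_imp_sets[OF N] \<open>0 < \<eta>\<close>])
    moreover from this have "U \<in> lmeasurable"
      using fmeasurable.Un[of "U - N" lebesgue N] negligible_imp_measurable[OF N]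
      by (simp add: Un_absorb2)
    moreover have "measure lebesgue U = measure lebesgue (U - N)"
      using N \<open>U \<in> lmeasurable\<close>
      by (intro measure_Diff_null_set[symmetric]) (auto simp: negligible_iff_null_sets fmeasurableD)
    ultimately show thesis
      using that \<open>0 < \<eta>\<close> by (simp add: emeasure_eq_measure2 ennreal_less_iff)
  qed
  have "\<exists>r>0. \<forall>s\<in>{a..b}. \<bar>s - t\<bar> < r \<longrightarrow>
      (t \<le> s \<longrightarrow> f s - f t \<le> (K + \<epsilon>) * (s - t)) \<and> (s \<le> t \<longrightarrow> f t - f s \<le> (K + \<epsilon>) * (t - s))"
    if t: "t \<in> {a..b} - N" for t
  proof -
    obtain d where d: "d \<le> K" "(f has_real_derivative d) (at t within {a..b})"
      using deriv[OF t] by blast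
    then obtain r where r: "r > 0"
      "\<And>s. \<lbrakk>s \<in> {a..b}; norm (s - t) < r\<rbrakk> \<Longrightarrow> norm (f s - f t - d * (s - t)) \<le> \<epsilon> * norm (s - t)"
      using \<open>0 < \<epsilon>\<close> unfolding has_field_derivative_def has_derivative_within_alt by blast
    have "f s - f t \<le> (K + \<epsilon>) * (s - t)" if "s \<in> {a..b}" "\<bar>s - t\<bar> < r" "t \<le> s" for s
    proof -
      have "f s - f t \<le> (d + \<epsilon>) * (s - t)"
        using r(2)[of s] that by (simp add: algebra_simps abs_le_iff)
      also have "\<dots> \<le> (K + \<epsilon>) * (s - t)"
        using d(1) that by (intro mult_right_mono) auto
      finally show ?thesis .
    qed
    moreover have "f t - f s \<le> (K + \<epsilon>) * (t - s)" if "s \<in> {a..b}" "\<bar>s - t\<bar> < r" "s \<le> t" for s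
    proof -
      have "f t - f s \<le> (d + \<epsilon>) * (t - s)"
        using r(2)[of s] that by (simp add: algebra_simps abs_le_iff)
      also have "\<dots> \<le> (K + \<epsilon>) * (t - s)"
        using d(1) that by (intro mult_right_mono) auto
      finally show ?thesis .
    qed
    ultimately show ?thesis
      using r(1) by blast
  qed
  then obtain r where r: "\<And>t. t \<in> {a..b} - N \<Longrightarrow> r t > 0"
    "\<And>t s. \<lbrakk>t \<in> {a..b} - N; s \<in> {a..b}; \<bar>s - t\<bar> < r t; t \<le> s\<rbrakk> \<Longrightarrow> f s - f t \<le> (K + \<epsilon>) * (s - t)"
    "\<And>t s. \<lbrakk>t \<in> {a..b} - N; s \<in> {a..b}; \<bar>s - t\<bar> < r t; s \<le> t\<rbrakk> \<Longrightarrow> f t - f s \<le> (K + \<epsilon>) * (t - s)"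
    by metis
  define \<gamma> where "\<gamma> t = (if t \<in> N then U else if t \<in> {a..b} then ball t (r t) else ball t 1)" for t
  have "gauge \<gamma>"
    using U r(1) by (auto simp: gauge_def \<gamma>_def)
  then obtain p where p: "p tagged_division_of {a..b}" "\<gamma> fine p"
    using fine_division_exists_real by blast
  define len where "len k = Sup k - Inf k" for k :: "real set"
  define inc where "inc k = f (Sup k) - f (Inf k)" for k
  have finp: "finite p"
    using p(1) by auto
  have box: "\<exists>u v. k = {u..v} \<and> u \<le> t \<and> t \<le> v \<and> a \<le> u \<and> v \<le> b \<and> len k = v - u \<and> inc k = f v - f u"
    if tk: "(t, k) \<in> p" for t k
  proof -
    obtain u v where k: "k = {u..v}"
      using tagged_division_ofD(4)[OF p(1) tk] by auto
    moreover have "t \<in> k" "k \<subseteq> {a..b}"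
      using tagged_division_ofD(2,3)[OF p(1) tk] by auto
    ultimately show ?thesis
      by (intro exI[of _ u] exI[of _ v]) (auto simp: len_def inc_def)
  qed
  \<comment> \<open>degenerate intervals are left out, so that distinct elements have distinct
    endpoints\<close>
  define p1 where "p1 = {(t, k) \<in> p. t \<in> N \<and> len k > 0}"
  have p1p: "p1 \<subseteq> p"
    by (auto simp: p1_def)
  have split: "(\<Sum>(t, k)\<in>p. h k) = (\<Sum>(t, k)\<in>p - p1. h k) + (\<Sum>(t, k)\<in>p1. h k)" for h :: "real set \<Rightarrow> real"
    using sum.subset_diff[OF p1p finp] .
  have disj: "interior k \<inter> interior k' = {}" if "(t, k) \<in> p1" "(t', k') \<in> p1" "(t, k) \<noteq> (t', k')" for t k t' k'
    using tagged_division_ofD(5)[OF p(1), of t k t' k'] that p1p by blast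
  have box1: "\<exists>u v. k = {u..v} \<and> u < v \<and> u \<le> t \<and> t \<le> v \<and> a \<le> u \<and> v \<le> b \<and> len k = v - u \<and> inc k = f v - f u"
    if tk: "(t, k) \<in> p1" for t k
    using box[of t k] tk by (fastforce simp: p1_def)
  have inj: "inj_on snd p1"
  proof (rule inj_onI)
    fix i j assume ij: "i \<in> p1" "j \<in> p1" "snd i = snd j"
    then obtain t t' k where tk: "i = (t, k)" "j = (t', k)"
      by (metis prod.collapse)
    obtain u v where "k = {u..v}" "u < v"
      using box1[of t k] ij(1) tk by blast
    then have "interior k \<inter> interior k \<noteq> {}"
      by simp
    then show "i = j"
      using disj[of t k t' k] ij tk by blast
  qed
  have finp1: "finite p1"
    using finp p1p by (rule finite_subset[rotated])
  have len1: "(\<Sum>(t, k)\<in>p1. len k) < \<eta>"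
  proof -
    have "p1 tagged_partial_division_of {a..b}"
      using p(1) p1p unfolding tagged_division_of_def by (blast intro: tagged_partial_division_subset)
    then have div: "snd ` p1 division_of \<Union>(snd ` p1)"
      by (rule partial_division_of_tagged_division)
    have "(\<Sum>(t, k)\<in>p1. len k) = sum (len \<circ> snd) p1"
      by (simp add: case_prod_unfold)
    also have "\<dots> = sum len (snd ` p1)"
      using inj by (simp add: sum.reindex)
    also have "\<dots> = sum (measure lebesgue) (snd ` p1)"
    proof (rule sum.cong)
      fix k assume "k \<in> snd ` p1"
      then obtain t where "(t, k) \<in> p1" by auto
      from box1[OF this] show "len k = measure lebesgue k" by auto
    qed simp
    also have "\<dots> = measure lebesgue (\<Union>(snd ` p1))"
      by (rule content_division[OF div])
    also have "\<dots> \<le> measure lebesgue U"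
    proof (rule measure_mono_fmeasurable[OF _ _ U(3)])
      show "\<Union>(snd ` p1) \<subseteq> U"
      proof (rule Union_least, elim imageE, hypsubst)
        fix i assume "i \<in> p1"
        then have "(fst i, snd i) \<in> p" "fst i \<in> N"
          by (auto simp: p1_def)
        then show "snd i \<subseteq> U"
          using fineD[OF p(2), of "fst i" "snd i"] by (simp add: \<gamma>_def)
      qed
      show "\<Union>(snd ` p1) \<in> sets lebesgue"
        using lmeasurable_division[OF div] by (rule fmeasurableD)
    qed
    finally show ?thesis
      using U(4) by simp
  qed
  have "(\<Sum>(t, k)\<in>p1. \<bar>inc k\<bar>) < \<epsilon>"
  proof -
    define ends where "ends = (\<lambda>(t :: real, k :: real set). (Inf k, Sup k))"
    have ends_snd: "snd i = {fst (ends i)..snd (ends i)}" if i: "i \<in> p1" for i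
    proof -
      have "(fst i, snd i) \<in> p1"
        using i by simp
      from box1[OF this] obtain u v where "snd i = {u..v}" "u < v"
        by blast
      then show ?thesis
        by (simp add: ends_def case_prod_unfold)
    qed
    have inj_ends: "inj_on ends p1"
      using ends_snd inj unfolding inj_on_def by metis
    have "(\<Sum>(u, v)\<in>ends ` p1. norm (f v - f u)) < \<epsilon>"
    proof (rule small)
      show "finite (ends ` p1)"
        using finp1 by simp
      show "\<forall>(u, v)\<in>ends ` p1. a \<le> u \<and> u \<le> v \<and> v \<le> b"
      proof (intro ballI; elim imageE; hypsubst)
        fix i assume "i \<in> p1"
        then have "(fst i, snd i) \<in> p1"
          by simp
        from box1[OF this] obtain u v where "snd i = {u..v}" "a \<le> u" "u < v" "v \<le> b"
          by blast
        then show "case ends i of (u, v) \<Rightarrow> a \<le> u \<and> u \<le> v \<and> v \<le> b"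
          by (simp add: ends_def case_prod_unfold)
      qed
      show "pairwise (\<lambda>(u, v) (u', v'). disjnt {u<..<v} {u'<..<v'}) (ends ` p1)"
      proof (rule pairwise_imageI)
        fix i j assume ij: "i \<in> p1" "j \<in> p1" "i \<noteq> j"
        then have "interior (snd i) \<inter> interior (snd j) = {}"
          using disj[of "fst i" "snd i" "fst j" "snd j"] by auto
        then show "(\<lambda>(u, v) (u', v'). disjnt {u<..<v} {u'<..<v'}) (ends i) (ends j)"
          unfolding ends_snd[OF ij(1)] ends_snd[OF ij(2)] by (auto simp: disjnt_def case_prod_unfold)
      qed
      have "(\<Sum>(u, v)\<in>ends ` p1. v - u) = (\<Sum>(t, k)\<in>p1. len k)"
        using inj_ends by (simp add: sum.reindex case_prod_unfold ends_def len_def)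
      then show "(\<Sum>(u, v)\<in>ends ` p1. v - u) < \<delta>"
        using len1 by (simp add: \<eta>_def)
    qed
    also have "(\<Sum>(u, v)\<in>ends ` p1. norm (f v - f u)) = (\<Sum>(t, k)\<in>p1. \<bar>inc k\<bar>)"
      using inj_ends by (simp add: sum.reindex case_prod_unfold ends_def inc_def)
    finally show ?thesis .
  qed
  then have inc1: "(\<Sum>(t, k)\<in>p1. inc k) \<le> \<epsilon>"
    by (smt (verit, best) sum_mono case_prod_unfold)
  have inc2: "inc k \<le> (K + \<epsilon>) * len k" if tk: "(t, k) \<in> p - p1" for t k
  proof -
    obtain u v where k: "k = {u..v}" "u \<le> t" "t \<le> v" "a \<le> u" "v \<le> b" "len k = v - u" "inc k = f v - f u"
      using box[of t k] tk by blast
    show ?thesis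
    proof (cases "t \<in> N")
      case True
      then have "u = v"
        using tk k by (auto simp: p1_def)
      then show ?thesis using k by simp
    next
      case False
      then have t: "t \<in> {a..b} - N" using k by auto
      have "k \<subseteq> ball t (r t)"
        using fineD[OF p(2), of t k] tk t by (auto simp: \<gamma>_def)
      moreover have "u \<in> k" "v \<in> k"
        using k by auto
      ultimately have "u \<in> ball t (r t)" "v \<in> ball t (r t)"
        by blast+
      then have "f v - f t \<le> (K + \<epsilon>) * (v - t)" "f t - f u \<le> (K + \<epsilon>) * (t - u)"
        using r(2)[of t v] r(3)[of t u] t k by (auto simp: dist_real_def)
      then show ?thesis
        unfolding k(6,7) by (simp add: algebra_simps)
    qed
  qed
  have "f b - f a = (\<Sum>(t, k)\<in>p. inc k)"
    using additive_tagged_division_1[OF ab p(1), of f] by (simp add: inc_def)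
  also have "\<dots> \<le> (\<Sum>(t, k)\<in>p - p1. (K + \<epsilon>) * len k) + \<epsilon>"
    unfolding split using inc1 inc2 by (intro add_mono sum_mono) auto
  also have "(\<Sum>(t, k)\<in>p - p1. (K + \<epsilon>) * len k) = (K + \<epsilon>) * (\<Sum>(t, k)\<in>p - p1. len k)"
    by (simp add: sum_distrib_left case_prod_unfold)
  also have "(\<Sum>(t, k)\<in>p - p1. len k) = (b - a) - (\<Sum>(t, k)\<in>p1. len k)"
    using additive_tagged_division_1[OF ab p(1), of "\<lambda>t. t"] split[of len] by (simp add: len_def)
  also have "(K + \<epsilon>) * (b - a - (\<Sum>(t, k)\<in>p1. len k)) + \<epsilon> \<le> K * (b - a) + \<epsilon> * (b - a + 2)"
  proof -
    define s where "s = (\<Sum>(t, k)\<in>p1. len k)"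
    have "0 \<le> s"
      unfolding s_def by (rule sum_nonneg) (auto simp: p1_def)
    moreover have "\<bar>K\<bar> * s \<le> \<epsilon>"
    proof -
      have "\<bar>K\<bar> * s \<le> \<bar>K\<bar> * (\<epsilon> / (\<bar>K\<bar> + 1))"
        using len1 by (intro mult_left_mono) (auto simp: s_def \<eta>_def)
      also have "\<dots> \<le> \<epsilon>"
        using \<open>0 < \<epsilon>\<close> by (simp add: field_simps)
      finally show ?thesis .
    qed
    moreover have "- K * s \<le> \<bar>K\<bar> * s"
      using \<open>0 \<le> s\<close> by (intro mult_right_mono) auto
    moreover have "0 \<le> \<epsilon> * s"
      using \<open>0 \<le> s\<close> \<open>0 < \<epsilon>\<close> by simp
    ultimately show ?thesis
      unfolding s_def[symmetric] by (simp add: algebra_simps)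
  qed
  also have "\<dots> = K * (b - a) + e"
    using ab by (simp add: \<epsilon>_def)
  finally show "f b - f a \<le> K * (b - a) + e" .
qed

lemma abs_continuous_inner:
  assumes ac: "abs_continuous_on_interval a b x" and st: "a \<le> s" "t \<le> b"
  shows "abs_continuous_on_interval s t (\<lambda>\<tau>. x \<tau> \<bullet> w)"
  unfolding abs_continuous_on_interval_def
proof (intro allI impI)
  fix \<epsilon> :: real assume "0 < \<epsilon>"
  then have "0 < \<epsilon> / (norm w + 1)"
    by (simp add: add_nonneg_pos)
  then obtain \<delta> where \<delta>: "\<delta> > 0"
    and small: "\<And>P. \<lbrakk>finite P; \<forall>(u, v)\<in>P. a \<le> u \<and> u \<le> v \<and> v \<le> b;
        pairwise (\<lambda>(u, v) (u', v'). disjnt {u<..<v} {u'<..<v'}) P; (\<Sum>(u, v)\<in>P. v - u) < \<delta>\<rbrakk>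
      \<Longrightarrow> (\<Sum>(u, v)\<in>P. norm (x v - x u)) < \<epsilon> / (norm w + 1)"
    using ac unfolding abs_continuous_on_interval_def by meson
  show "\<exists>\<delta>>0. \<forall>P. finite P \<and> (\<forall>(u, v)\<in>P. s \<le> u \<and> u \<le> v \<and> v \<le> t) \<and>
        pairwise (\<lambda>(u, v) (u', v'). disjnt {u<..<v} {u'<..<v'}) P \<and> (\<Sum>(u, v)\<in>P. v - u) < \<delta> \<longrightarrow>
        (\<Sum>(u, v)\<in>P. norm (x v \<bullet> w - x u \<bullet> w)) < \<epsilon>"
  proof (intro exI[of _ \<delta>] conjI allI impI; (elim conjE)?)
    fix P assume P: "finite P" "\<forall>(u, v)\<in>P. s \<le> u \<and> u \<le> v \<and> v \<le> t"
      "pairwise (\<lambda>(u, v) (u', v'). disjnt {u<..<v} {u'<..<v'}) P" "(\<Sum>(u, v)\<in>P. v - u) < \<delta>"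
    have "(\<Sum>(u, v)\<in>P. norm (x v - x u)) < \<epsilon> / (norm w + 1)"
      using P st by (intro small) auto
    then have "(norm w + 1) * (\<Sum>(u, v)\<in>P. norm (x v - x u)) < \<epsilon>"
      by (simp add: pos_less_divide_eq add_nonneg_pos mult.commute)
    moreover have "(\<Sum>(u, v)\<in>P. norm (x v \<bullet> w - x u \<bullet> w)) \<le> (\<Sum>(u, v)\<in>P. (norm w + 1) * norm (x v - x u))"
    proof (rule sum_mono, clarify)
      fix u v
      have "norm (x v \<bullet> w - x u \<bullet> w) \<le> norm (x v - x u) * norm w"
        using Cauchy_Schwarz_ineq2[of "x v - x u" w] by (simp add: inner_diff_left)
      also have "\<dots> \<le> (norm w + 1) * norm (x v - x u)"
        by (simp add: algebra_simps)
      finally show "norm (x v \<bullet> w - x u \<bullet> w) \<le> (norm w + 1) * norm (x v - x u)" .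
    qed
    ultimately show "(\<Sum>(u, v)\<in>P. norm (x v \<bullet> w - x u \<bullet> w)) < \<epsilon>"
      by (simp add: sum_distrib_left case_prod_unfold)
  qed (fact \<delta>)
qed

lemma lipschitz_imp_abs_continuous:
  assumes x: "L-lipschitz_on {a..b} x"
  shows "abs_continuous_on_interval a b x"
  unfolding abs_continuous_on_interval_def
proof (intro allI impI)
  fix \<epsilon> :: real assume "0 < \<epsilon>"
  have L: "0 \<le> L"
    using x by (rule lipschitz_on_nonneg)
  show "\<exists>\<delta>>0. \<forall>P. finite P \<and> (\<forall>(u, v)\<in>P. a \<le> u \<and> u \<le> v \<and> v \<le> b) \<and>
        pairwise (\<lambda>(u, v) (u', v'). disjnt {u<..<v} {u'<..<v'}) P \<and> (\<Sum>(u, v)\<in>P. v - u) < \<delta> \<longrightarrow>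
        (\<Sum>(u, v)\<in>P. norm (x v - x u)) < \<epsilon>"
  proof (intro exI[of _ "\<epsilon> / (L + 1)"] conjI allI impI; (elim conjE)?)
    fix P assume P: "\<forall>(u, v)\<in>P. a \<le> u \<and> u \<le> v \<and> v \<le> b" "(\<Sum>(u, v)\<in>P. v - u) < \<epsilon> / (L + 1)"
    have "(\<Sum>(u, v)\<in>P. norm (x v - x u)) \<le> (\<Sum>(u, v)\<in>P. (L + 1) * (v - u))"
    proof (rule sum_mono, clarify)
      fix u v assume "(u, v) \<in> P"
      with P have uv: "u \<le> v" "u \<in> {a..b}" "v \<in> {a..b}" by auto
      have "norm (x v - x u) \<le> L * (v - u)"
        using lipschitz_on_normD[OF x uv(3,2)] uv(1) by simp
      also have "\<dots> \<le> (L + 1) * (v - u)"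
        using uv(1) by (intro mult_right_mono) auto
      finally show "norm (x v - x u) \<le> (L + 1) * (v - u)" .
    qed
    also have "\<dots> = (L + 1) * (\<Sum>(u, v)\<in>P. v - u)"
      by (simp add: sum_distrib_left case_prod_unfold)
    also have "\<dots> < \<epsilon>"
      using P(2) L by (simp add: pos_less_divide_eq mult.commute)
    finally show "(\<Sum>(u, v)\<in>P. norm (x v - x u)) < \<epsilon>" .
  qed (use L \<open>0 < \<epsilon>\<close> in auto)
qed

lemma abs_continuous_imp_continuous:
  assumes ac: "abs_continuous_on_interval a b x"
  shows "continuous_on {a..b} x"
  unfolding continuous_on_iff
proof (intro ballI allI impI)
  fix s e :: real assume s: "s \<in> {a..b}" and "0 < e"
  then obtain \<delta> where \<delta>: "\<delta> > 0"
    and small: "\<And>P. \<lbrakk>finite P; \<forall>(u, v)\<in>P. a \<le> u \<and> u \<le> v \<and> v \<le> b;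
        pairwise (\<lambda>(u, v) (u', v'). disjnt {u<..<v} {u'<..<v'}) P; (\<Sum>(u, v)\<in>P. v - u) < \<delta>\<rbrakk>
      \<Longrightarrow> (\<Sum>(u, v)\<in>P. norm (x v - x u)) < e"
    using ac unfolding abs_continuous_on_interval_def by meson
  show "\<exists>d>0. \<forall>t\<in>{a..b}. dist t s < d \<longrightarrow> dist (x t) (x s) < e"
  proof (intro exI[of _ \<delta>] conjI ballI impI)
    fix t assume "t \<in> {a..b}" "dist t s < \<delta>"
    with s small[of "{(min s t, max s t)}"] show "dist (x t) (x s) < e"
      by (cases "s \<le> t") (auto simp: dist_norm norm_minus_commute)
  qed (fact \<delta>)
qed

text \<open>Apply \<open>abs_continuous_upper_bound\<close> to the component of \<open>x\<close> in
  the direction of the increment under consideration.\<close>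

lemma abs_continuous_imp_lipschitz:
  fixes x :: "real \<Rightarrow> 'a::euclidean_space"
  assumes ac: "abs_continuous_on_interval a b x" and M: "0 \<le> M" and N: "negligible N"
    and deriv: "\<And>t. t \<in> {a..b} - N \<Longrightarrow> \<exists>v. norm v \<le> M \<and> (x has_vector_derivative v) (at t within {a..b})"
  shows "M-lipschitz_on {a..b} x"
proof (rule lipschitz_on_leI)
  fix s t assume st: "s \<in> {a..b}" "t \<in> {a..b}" "s \<le> t"
  define w where "w = x t - x s"
  have "x t \<bullet> w - x s \<bullet> w \<le> M * norm w * (t - s)"
  proof (rule abs_continuous_upper_bound[OF abs_continuous_inner[OF ac] st(3) N])
    fix \<tau> assume \<tau>: "\<tau> \<in> {s..t} - N"
    then obtain v where v: "norm v \<le> M" "(x has_vector_derivative v) (at \<tau> within {a..b})"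
      using deriv[of \<tau>] st by auto
    have "(x has_vector_derivative v) (at \<tau> within {s..t})"
      using v(2) st by (rule_tac has_vector_derivative_within_subset) auto
    then have "((\<lambda>\<tau>. x \<tau> \<bullet> w) has_real_derivative v \<bullet> w) (at \<tau> within {s..t})"
      unfolding has_real_derivative_iff_has_vector_derivative
      by (rule bounded_linear.has_vector_derivative[OF bounded_linear_inner_left])
    moreover have "v \<bullet> w \<le> M * norm w"
      using norm_cauchy_schwarz[of v w] mult_right_mono[OF v(1), of "norm w"] by simp
    ultimately show "\<exists>d\<le>M * norm w. ((\<lambda>\<tau>. x \<tau> \<bullet> w) has_real_derivative d) (at \<tau> within {s..t})"
      by blast
  qed (use st in auto)
  moreover have "x t \<bullet> w - x s \<bullet> w = norm w * norm w"
    by (simp add: w_def inner_diff_left[symmetric] dot_square_norm power2_eq_square)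
  ultimately have "norm w * norm w \<le> norm w * (M * (t - s))"
    by (simp add: mult_ac)
  then have "norm w \<le> M * (t - s)"
    using M st(3) by (cases "norm w = 0") (simp_all add: mult_le_cancel_left)
  then show "dist (x s) (x t) \<le> M * dist s t"
    using st(3) by (simp add: w_def dist_norm norm_minus_commute)
qed (fact M)

lemma abs_continuous_subinterval:
  assumes "abs_continuous_on_interval a b x" "a \<le> s" "t \<le> b"
  shows "abs_continuous_on_interval s t x"
  unfolding abs_continuous_on_interval_def
proof (intro allI impI)
  fix \<epsilon> :: real assume "0 < \<epsilon>"
  then obtain \<delta> where \<delta>: "\<delta> > 0"
    and small: "\<forall>P. finite P \<and> (\<forall>(u, v)\<in>P. a \<le> u \<and> u \<le> v \<and> v \<le> b) \<and>
        pairwise (\<lambda>(u, v) (u', v'). disjnt {u<..<v} {u'<..<v'}) P \<and> (\<Sum>(u, v)\<in>P. v - u) < \<delta>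
      \<longrightarrow> (\<Sum>(u, v)\<in>P. norm (x v - x u)) < \<epsilon>"
    using assms(1) unfolding abs_continuous_on_interval_def by meson
  show "\<exists>\<delta>>0. \<forall>P. finite P \<and> (\<forall>(u, v)\<in>P. s \<le> u \<and> u \<le> v \<and> v \<le> t) \<and>
        pairwise (\<lambda>(u, v) (u', v'). disjnt {u<..<v} {u'<..<v'}) P \<and> (\<Sum>(u, v)\<in>P. v - u) < \<delta>
      \<longrightarrow> (\<Sum>(u, v)\<in>P. norm (x v - x u)) < \<epsilon>"
  proof (intro exI[of _ \<delta>] conjI allI impI; (elim conjE)?)
    fix P assume P: "finite P" "\<forall>(u, v)\<in>P. s \<le> u \<and> u \<le> v \<and> v \<le> t"
      "pairwise (\<lambda>(u, v) (u', v'). disjnt {u<..<v} {u'<..<v'}) P" "(\<Sum>(u, v)\<in>P. v - u) < \<delta>"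
    have "\<forall>(u, v)\<in>P. a \<le> u \<and> u \<le> v \<and> v \<le> b"
      using P(2) assms(2,3) by auto
    with small P show "(\<Sum>(u, v)\<in>P. norm (x v - x u)) < \<epsilon>"
      by blast
  qed (fact \<delta>)
qed

section \<open>Filippov solutions and their local existence\<close>

lemma AE_lebesgue_on_iff_negligible:
  assumes "S \<in> sets lebesgue"
  shows "(AE t in lebesgue_on S. P t) \<longleftrightarrow> negligible {t \<in> S. \<not> P t}"
proof -
  have "(AE t in lebesgue_on S. P t) \<longleftrightarrow> (AE t in lebesgue. t \<in> S \<longrightarrow> P t)"
    using assms by (simp add: AE_restrict_space_iff)
  also have "\<dots> \<longleftrightarrow> negligible {t \<in> S. \<not> P t}"
  proof
    assume "AE t in lebesgue. t \<in> S \<longrightarrow> P t"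
    then obtain N where "N \<in> null_sets lebesgue" "{t \<in> space lebesgue. \<not> (t \<in> S \<longrightarrow> P t)} \<subseteq> N"
      unfolding eventually_ae_filter by blast
    then show "negligible {t \<in> S. \<not> P t}"
      unfolding negligible_iff_null_sets[symmetric] by (auto elim: negligible_subset)
  next
    assume "negligible {t \<in> S. \<not> P t}"
    then show "AE t in lebesgue. t \<in> S \<longrightarrow> P t"
      unfolding negligible_iff_null_sets by (intro AE_I'[of "{t \<in> S. \<not> P t}"]) auto
  qed
  finally show ?thesis .
qed

lemma filippov_solution_iff:
  "filippov_solution X T x \<longleftrightarrow> abs_continuous_on_interval 0 T x \<and>
    negligible {t \<in> {0..T}. \<not> (\<exists>v\<in>filippov X (x t). (x has_vector_derivative v) (at t within {0..T}))}"
  unfolding filippov_solution_def by (subst AE_lebesgue_on_iff_negligible) auto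

lemma filippov_solution_subinterval:
  assumes sol: "filippov_solution X T x" and "T' \<le> T"
  shows "filippov_solution X T' x"
  unfolding filippov_solution_iff
proof
  show "abs_continuous_on_interval 0 T' x"
    using sol assms(2) unfolding filippov_solution_iff by (blast intro: abs_continuous_subinterval)
  have "negligible {t \<in> {0..T}. \<not> (\<exists>v\<in>filippov X (x t). (x has_vector_derivative v) (at t within {0..T}))}"
    using sol unfolding filippov_solution_iff by blast
  then show "negligible {t \<in> {0..T'}. \<not> (\<exists>v\<in>filippov X (x t). (x has_vector_derivative v) (at t within {0..T'}))}"
  proof (rule negligible_subset)
    have "(x has_vector_derivative v) (at t within {0..T'})"
      if "(x has_vector_derivative v) (at t within {0..T})" for t v
      using has_vector_derivative_within_subset[OF that] assms(2) by simp
    then show "{t \<in> {0..T'}. \<not> (\<exists>v\<in>filippov X (x t). (x has_vector_derivative v) (at t within {0..T'}))} \<subseteq>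
        {t \<in> {0..T}. \<not> (\<exists>v\<in>filippov X (x t). (x has_vector_derivative v) (at t within {0..T}))}"
      using order_trans[OF _ assms(2)] by auto
  qed
qed

text \<open>Derivatives within a time interval are local, so they survive when a solution is
  restricted, extended or glued away from the time in question.\<close>

lemma has_vector_derivative_local_transfer:
  fixes x y :: "real \<Rightarrow> 'a::real_normed_vector"
  assumes deriv: "(x has_vector_derivative v) (at t within A)" and U: "open U" "t \<in> U" and "t \<in> A"
    and same: "A \<inter> U = B \<inter> U" and eq: "\<And>s. s \<in> A \<inter> U \<Longrightarrow> x s = y s"
  shows "(y has_vector_derivative v) (at t within B)"
proof -
  have "at t within A = at t within B"
    by (rule at_within_nhd[OF U(2,1)]) (use same in auto)
  with deriv have deriv_B: "(x has_vector_derivative v) (at t within B)"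
    by simp
  obtain d where d: "d > 0" "ball t d \<subseteq> U"
    by (rule openE[OF U])
  have "t \<in> B"
    using U(2) \<open>t \<in> A\<close> same by blast
  have near: "x s = y s" if s: "s \<in> B" "dist s t < d" for s
  proof -
    have "s \<in> ball t d"
      using s(2) by (simp add: dist_commute)
    then show ?thesis
      using d(2) same s(1) by (intro eq) blast
  qed
  show ?thesis
    by (rule has_vector_derivative_transform_within[OF deriv_B d(1) \<open>t \<in> B\<close>]) (rule near)
qed

definition filippov_at :: "('a::euclidean_space \<Rightarrow> 'a) \<Rightarrow> real set \<Rightarrow> (real \<Rightarrow> 'a) \<Rightarrow> real \<Rightarrow> bool" where
  "filippov_at X S x t \<longleftrightarrow> (\<exists>v\<in>filippov X (x t). (x has_vector_derivative v) (at t within S))"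

lemma filippov_at_local_transfer:
  assumes "filippov_at X A x t" "open U" "t \<in> U" "t \<in> A" "A \<inter> U = B \<inter> U" "\<And>s. s \<in> A \<inter> U \<Longrightarrow> x s = y s"
  shows "filippov_at X B y t"
proof -
  obtain v where v: "v \<in> filippov X (x t)" "(x has_vector_derivative v) (at t within A)"
    using assms(1) unfolding filippov_at_def by blast
  have "x t = y t"
    using assms(3,4) by (intro assms(6)) blast
  moreover have "(y has_vector_derivative v) (at t within B)"
    using v(2) assms(2-6) by (rule has_vector_derivative_local_transfer)
  ultimately show ?thesis
    using v(1) unfolding filippov_at_def by auto
qed

lemma lipschitz_filippov_solution:
  assumes "L-lipschitz_on {0..T} x" "negligible {t \<in> {0..T}. \<not> filippov_at X {0..T} x t}"
  shows "filippov_solution X T x"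
  using assms lipschitz_imp_abs_continuous unfolding filippov_solution_iff filippov_at_def by blast

text \<open>The part of the time interval from \<open>0\<close> to \<open>t\<close> that falls into
  the \<open>k\<close>-th step of length \<open>h\<close>. A polygon with step velocities \<open>w
  k\<close> is the sum of \<open>elapsed h k t *\<^sub>R w k\<close>; no case distinction on the
  current step is needed.\<close>

definition elapsed :: "real \<Rightarrow> nat \<Rightarrow> real \<Rightarrow> real" where
  "elapsed h k t = max 0 (min (t - real k * h) h)"

lemma elapsed_sum:
  assumes "0 \<le> t" "0 \<le> h"
  shows "(\<Sum>k<n. elapsed h k t) = min t (real n * h)"
  using assms by (induction n) (auto simp: elapsed_def algebra_simps min_def max_def)

lemma elapsed_at_node:
  assumes "0 \<le> h"
  shows "elapsed h k (real j * h) = (if k < j then h else 0)"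
proof (cases "k < j")
  case True
  then have "(real k + 1) * h \<le> real j * h"
    using assms by (intro mult_right_mono) auto
  then show ?thesis
    using True assms by (simp add: elapsed_def algebra_simps)
next
  case False
  then have "real j * h \<le> real k * h"
    using assms by (intro mult_right_mono) auto
  then show ?thesis
    using False assms by (simp add: elapsed_def)
qed

lemma elapsed_mono: "s \<le> t \<Longrightarrow> elapsed h k s \<le> elapsed h k t"
  by (auto simp: elapsed_def)

lemma elapsed_eq_unless:
  assumes "s \<le> t" "0 \<le> h" "t \<le> real k * h \<or> real k * h + h \<le> s"
  shows "elapsed h k t = elapsed h k s"
  using assms by (auto simp: elapsed_def)

lemma ball_not_subset_negligible:
  fixes q :: "'a::euclidean_space"
  assumes "negligible S" "0 < h"
  shows "\<exists>z. z \<in> ball q h - S"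
proof -
  have "\<not> ball q h \<subseteq> S"
    using assms negligible_subset[of S "ball q h"] open_not_negligible[of "ball q h"] by auto
  then show ?thesis by blast
qed

text \<open>The velocity of each step is sampled near the current node but off the null set
  \<open>S0\<close>, because values of \<open>X\<close> on null sets do not enter the Filippov set.
  Every difference quotient of the polygon is a convex combination of the velocities of the steps
  that meet the time interval.\<close>

lemma euler_polygon:
  fixes X :: "'a::euclidean_space \<Rightarrow> 'a"
  assumes M: "0 \<le> M" and bnd: "\<forall>y\<in>ball x0 r. norm (X y) \<le> M"
    and S0: "negligible S0" and h: "0 < h" and fit: "real n * h * M + h < r"
  shows "\<exists>p. p 0 = x0 \<and> M-lipschitz_on {0..real n * h} p \<and>
    (\<forall>s\<in>{0..real n * h}. \<forall>t\<in>{0..real n * h}. s < t \<longrightarrow>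
       (p t - p s) /\<^sub>R (t - s) \<in> convex hull (X ` (ball (p s) (h + M * (h + (t - s))) - S0)))"
proof -
  have "\<exists>z. z \<in> ball q h - S0" for q
    using S0 h by (rule ball_not_subset_negligible)
  then obtain \<zeta> where \<zeta>: "\<And>q. \<zeta> q \<in> ball q h - S0"
    by metis
  define node where "node = rec_nat x0 (\<lambda>_ q. q + h *\<^sub>R X (\<zeta> q))"
  have node_0: "node 0 = x0" and node_Suc: "\<And>k. node (Suc k) = node k + h *\<^sub>R X (\<zeta> (node k))"
    by (simp_all add: node_def)
  define w where "w k = X (\<zeta> (node k))" for k
  have node_sum: "node k = x0 + (\<Sum>j<k. h *\<^sub>R w j)" for k
    by (induction k) (simp_all add: node_0 node_Suc w_def)
  have inside: "k \<le> n \<Longrightarrow> norm (node k - x0) \<le> real k * h * M" for k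
  proof (induction k)
    case (Suc k)
    then have IH: "norm (node k - x0) \<le> real k * h * M" by simp
    have "real k * h * M \<le> real n * h * M"
      using Suc.prems h M by (intro mult_right_mono) auto
    moreover have "dist x0 (\<zeta> (node k)) \<le> norm (node k - x0) + dist (node k) (\<zeta> (node k))"
      by (metis dist_commute dist_norm dist_triangle)
    moreover have "dist (node k) (\<zeta> (node k)) < h"
      using \<zeta>[of "node k"] by auto
    ultimately have "\<zeta> (node k) \<in> ball x0 r"
      using IH fit by simp
    then have "norm (h *\<^sub>R X (\<zeta> (node k))) \<le> h * M"
      using bnd h by simp
    then have "norm (node (Suc k) - x0) \<le> real k * h * M + h * M"
      using IH norm_triangle_ineq[of "node k - x0" "h *\<^sub>R X (\<zeta> (node k))"]
      by (simp add: node_Suc algebra_simps)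
    then show ?case
      by (simp add: algebra_simps)
  qed (simp add: node_0)
  have w_bnd: "norm (w k) \<le> M" if "k < n" for k
  proof -
    have "real k * h * M \<le> real n * h * M"
      using that h M by (intro mult_right_mono) auto
    moreover have "dist x0 (\<zeta> (node k)) \<le> norm (node k - x0) + dist (node k) (\<zeta> (node k))"
      by (metis dist_commute dist_norm dist_triangle)
    moreover have "dist (node k) (\<zeta> (node k)) < h"
      using \<zeta>[of "node k"] by auto
    ultimately have "\<zeta> (node k) \<in> ball x0 r"
      using inside[of k] that fit by simp
    then show ?thesis
      using bnd by (simp add: w_def)
  qed
  define p where "p t = x0 + (\<Sum>k<n. elapsed h k t *\<^sub>R w k)" for t
  have diff: "p t - p s = (\<Sum>k<n. (elapsed h k t - elapsed h k s) *\<^sub>R w k)" for s t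
    by (simp add: p_def sum_subtractf scaleR_diff_left)
  have total: "(\<Sum>k<n. elapsed h k t - elapsed h k s) = t - s"
    if "s \<in> {0..real n * h}" "t \<in> {0..real n * h}" for s t
    using that h by (simp add: sum_subtractf elapsed_sum min_def)
  have p_node: "p (real k * h) = node k" if "k \<le> n" for k
  proof -
    have "(\<Sum>j<n. elapsed h j (real k * h) *\<^sub>R w j) = (\<Sum>j<n. if j < k then h *\<^sub>R w j else 0)"
      using h by (intro sum.cong) (auto simp: elapsed_at_node)
    also have "\<dots> = (\<Sum>j\<in>{..<n} \<inter> {..<k}. h *\<^sub>R w j)"
      by (subst sum.inter_restrict) auto
    also have "{..<n} \<inter> {..<k} = {..<k}"
      using that by auto
    finally show ?thesis
      by (simp add: p_def node_sum)
  qed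
  have lip: "M-lipschitz_on {0..real n * h} p"
  proof (rule lipschitz_on_leI)
    fix s t assume st: "s \<in> {0..real n * h}" "t \<in> {0..real n * h}" "s \<le> t"
    have "norm (p t - p s) \<le> (\<Sum>k<n. norm ((elapsed h k t - elapsed h k s) *\<^sub>R w k))"
      unfolding diff by (rule norm_sum)
    also have "\<dots> \<le> (\<Sum>k<n. (elapsed h k t - elapsed h k s) * M)"
      using elapsed_mono[OF st(3), of h] w_bnd
      by (intro sum_mono) (auto intro!: mult_left_mono)
    also have "\<dots> = M * (t - s)"
      using total[OF st(1,2)] by (simp add: sum_distrib_right[symmetric])
    finally show "dist (p s) (p t) \<le> M * dist s t"
      using st(3) by (simp add: dist_norm norm_minus_commute)
  qed (fact M)
  show ?thesis
  proof (intro exI[of _ p] conjI ballI impI)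
    show "p 0 = x0"
      using p_node[of 0] node_0 by simp
    fix s t assume st: "s \<in> {0..real n * h}" "t \<in> {0..real n * h}" "s < t"
    let ?C = "X ` (ball (p s) (h + M * (h + (t - s))) - S0)"
    define c where "c k = (elapsed h k t - elapsed h k s) / (t - s)" for k
    have c: "0 \<le> c k" for k
      using elapsed_mono[of s t h k] st(3) by (simp add: c_def)
    have c_sum: "(\<Sum>k<n. c k) = 1"
      using total[OF st(1,2)] st(3) by (simp add: c_def sum_divide_distrib[symmetric])
    have active: "w k \<in> ?C" if k: "k < n" "c k \<noteq> 0" for k
    proof -
      have "real k * h < t" "s < real k * h + h"
        using elapsed_eq_unless[of s t h k] k st(3) h by (auto simp: c_def not_le[symmetric])
      then have "dist s (real k * h) \<le> h + (t - s)"
        using h st(3) by (simp add: dist_real_def)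
      moreover have "real k * h \<in> {0..real n * h}"
        using k(1) h by (auto intro!: mult_right_mono)
      ultimately have "dist (p s) (node k) \<le> M * (h + (t - s))"
        using lipschitz_onD[OF lip st(1), of "real k * h"] p_node[of k] k(1) M
          mult_left_mono[of "dist s (real k * h)" "h + (t - s)" M] by simp
      moreover have "dist (node k) (\<zeta> (node k)) < h" "\<zeta> (node k) \<notin> S0"
        using \<zeta>[of "node k"] by auto
      moreover have "dist (p s) (\<zeta> (node k)) \<le> dist (p s) (node k) + dist (node k) (\<zeta> (node k))"
        by (rule dist_triangle)
      ultimately have "\<zeta> (node k) \<in> ball (p s) (h + M * (h + (t - s))) - S0"
        by simp
      then show ?thesis
        unfolding w_def by (rule imageI)
    qed
    let ?K = "{k. k < n \<and> c k \<noteq> 0}"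
    have "(\<Sum>k\<in>?K. c k *\<^sub>R w k) \<in> convex hull ?C"
    proof (rule convex_sum[OF _ convex_convex_hull])
      show "(\<Sum>k\<in>?K. c k) = 1"
        using c_sum by (subst sum.mono_neutral_left[of "{..<n}"]) auto
      show "w k \<in> convex hull ?C" if "k \<in> ?K" for k
        using active[of k] that by (intro hull_inc) simp
    qed (use c in auto)
    also have "(\<Sum>k\<in>?K. c k *\<^sub>R w k) = (\<Sum>k<n. c k *\<^sub>R w k)"
      by (rule sum.mono_neutral_left) auto
    also have "\<dots> = (p t - p s) /\<^sub>R (t - s)"
      unfolding diff by (simp add: c_def scaleR_sum_right divide_inverse mult.commute)
    finally show "(p t - p s) /\<^sub>R (t - s) \<in> convex hull ?C" .
  qed (fact lip)
qed

text \<open>Where \<open>X\<close> is continuous off one null set \<open>S0\<close>, that set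
  already realizes the intersection over all null sets: a point off \<open>S0\<close> is a limit of
  points off any other null set, and its image follows by continuity.\<close>

lemma filippov_if_generic:
  fixes X :: "'a::euclidean_space \<Rightarrow> 'a"
  assumes "0 < r" and cont: "\<And>z. z \<in> ball q r - S0 \<Longrightarrow> isCont X z"
    and v: "\<And>\<delta>. 0 < \<delta> \<Longrightarrow> v \<in> closure (convex hull (X ` (ball q \<delta> - S0)))"
  shows "v \<in> filippov X q"
  unfolding filippov_def
proof (intro INT_I)
  fix \<delta> :: real and S :: "'a set" assume "\<delta> \<in> {0<..}" "S \<in> null_sets lebesgue"
  then have \<delta>: "0 < \<delta>" and S: "negligible S"
    by (auto simp: negligible_iff_null_sets)
  define \<rho> where "\<rho> = min \<delta> r"
  have "X ` (ball q \<rho> - S0) \<subseteq> closure (X ` (ball q \<delta> - S))"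
  proof (rule image_subsetI)
    fix z assume z: "z \<in> ball q \<rho> - S0"
    show "X z \<in> closure (X ` (ball q \<delta> - S))"
      unfolding closure_approachable
    proof (intro allI impI)
      fix e :: real assume "0 < e"
      have "isCont X z"
        using z by (intro cont) (auto simp: \<rho>_def)
      then obtain d where d: "d > 0" "\<And>z'. dist z' z < d \<Longrightarrow> dist (X z') (X z) < e"
        using \<open>0 < e\<close> unfolding continuous_at_eps_delta by blast
      have "0 < min d (\<delta> - dist q z)"
        using d(1) z by (auto simp: \<rho>_def)
      from ball_not_subset_negligible[OF S this, of z]
      obtain z' where z': "z' \<in> ball z (min d (\<delta> - dist q z)) - S" by blast
      have "z' \<in> ball q \<delta> - S"
        using z' dist_triangle[of q z' z] by auto
      moreover have "dist (X z') (X z) < e"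
        using d(2)[of z'] z' by (simp add: dist_commute)
      ultimately show "\<exists>u\<in>X ` (ball q \<delta> - S). dist u (X z) < e"
        by blast
    qed
  qed
  also have "\<dots> \<subseteq> closure (convex hull (X ` (ball q \<delta> - S)))"
    by (intro closure_mono hull_subset)
  finally have "convex hull (X ` (ball q \<rho> - S0)) \<subseteq> closure (convex hull (X ` (ball q \<delta> - S)))"
    by (rule hull_minimal) (intro convex_closure convex_convex_hull)
  then have "closure (convex hull (X ` (ball q \<rho> - S0))) \<subseteq> closure (convex hull (X ` (ball q \<delta> - S)))"
    by (rule closure_minimal) simp
  moreover have "0 < \<rho>"
    using \<delta> \<open>0 < r\<close> by (simp add: \<rho>_def)
  ultimately show "v \<in> closure (convex hull (X ` (ball q \<delta> - S)))"
    using v[of \<rho>] by blast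
qed

lemma derivative_in_closed_slopes:
  fixes y :: "real \<Rightarrow> 'a::real_normed_vector"
  assumes "closed C" and deriv: "(y has_vector_derivative v) (at t within A)" and lim: "t islimpt A"
    and "0 < \<eta>"
    and slope: "\<And>s. \<lbrakk>s \<in> A; s \<noteq> t; \<bar>s - t\<bar> < \<eta>\<rbrakk> \<Longrightarrow> (y s - y t) /\<^sub>R (s - t) \<in> C"
  shows "v \<in> C"
proof -
  have "\<exists>c\<in>C. dist c v < e" if "0 < e" for e
  proof -
    obtain d where d: "d > 0"
      "\<And>s. \<lbrakk>s \<in> A; norm (s - t) < d\<rbrakk> \<Longrightarrow> norm (y s - y t - (s - t) *\<^sub>R v) \<le> e / 2 * norm (s - t)"
      using deriv half_gt_zero[OF \<open>0 < e\<close>] unfolding has_vector_derivative_def has_derivative_within_alt by blast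
    obtain s where s: "s \<in> A" "s \<noteq> t" "dist s t < min d \<eta>"
      using lim d(1) \<open>0 < \<eta>\<close> unfolding islimpt_approachable by (meson min_less_iff_conj)
    have "(y s - y t) /\<^sub>R (s - t) - v = (y s - y t - (s - t) *\<^sub>R v) /\<^sub>R (s - t)"
      using s(2) by (simp add: scaleR_diff_right)
    then have "dist ((y s - y t) /\<^sub>R (s - t)) v = norm (y s - y t - (s - t) *\<^sub>R v) / \<bar>s - t\<bar>"
      by (simp add: dist_norm divide_inverse mult.commute)
    also have "\<dots> \<le> e / 2"
      using d(2)[of s] s by (simp add: dist_real_def pos_divide_le_eq)
    finally show ?thesis
      using slope[of s] s \<open>0 < e\<close> by (force simp: dist_real_def)
  qed
  then show ?thesis
    using closed_approachable[OF \<open>closed C\<close>] by blast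
qed

text \<open>Euler polygons with step tending to zero are equi-Lipschitz, so by Arzela and Ascoli a
  subsequence converges uniformly to some \<open>y\<close>. Difference quotients of \<open>y\<close>
  over short intervals lie in the closed convex hulls of nearby values of \<open>X\<close>, hence so
  does every derivative of \<open>y\<close>; and \<open>y\<close>, being Lipschitz, has a derivative
  at almost every time.\<close>

lemma filippov_local_existence:
  fixes X :: "'a::euclidean_space \<Rightarrow> 'a"
  assumes r: "0 < r" and S0: "negligible S0"
    and M: "0 \<le> M" and bnd: "\<forall>z\<in>ball x0 r. norm (X z) \<le> M"
    and cont: "\<forall>z\<in>ball x0 r - S0. isCont X z"
  obtains \<tau> y where "0 < \<tau>" "y 0 = x0" "M-lipschitz_on {0..\<tau>} y"
    "negligible {t \<in> {0..\<tau>}. \<not> (\<exists>v\<in>filippov X (y t). (y has_vector_derivative v) (at t within {0..\<tau>}))}"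
proof -
  \<comment> \<open>short enough for nodes and sampling points to stay in the ball of radius
    \<open>r\<close>\<close>
  define \<tau> where "\<tau> = r / (2 * (M + 1))"
  have "\<tau> * (M + 1) = r / 2"
    using M by (simp add: \<tau>_def divide_simps)
  then have \<tau>2: "\<tau> * (M + 1) < r"
    using r by linarith
  have \<tau>1: "0 < \<tau>"
    using r M by (simp add: \<tau>_def)
  note \<tau> = \<tau>1 \<tau>2
  define h where "h n = \<tau> / real (Suc n)" for n
  have h: "0 < h n" "h n \<le> \<tau>" "real (Suc n) * h n = \<tau>" for n
    using \<tau>(1) by (auto simp: h_def field_simps)
  have "\<exists>p. p 0 = x0 \<and> M-lipschitz_on {0..\<tau>} p \<and> (\<forall>s\<in>{0..\<tau>}. \<forall>t\<in>{0..\<tau>}. s < t \<longrightarrow>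
      (p t - p s) /\<^sub>R (t - s) \<in> convex hull (X ` (ball (p s) (h n + M * (h n + (t - s))) - S0)))" for n
  proof -
    have fit: "real (Suc n) * h n * M + h n < r"
      unfolding h(3) using h(2)[of n] \<tau>(2) by (simp add: algebra_simps)
    from euler_polygon[OF M bnd S0 h(1) fit] show ?thesis
      unfolding h(3) .
  qed
  then obtain p where p0: "\<And>n. p n 0 = x0" and lip: "\<And>n. M-lipschitz_on {0..\<tau>} (p n)"
    and slope: "\<And>n s t. \<lbrakk>s \<in> {0..\<tau>}; t \<in> {0..\<tau>}; s < t\<rbrakk> \<Longrightarrow> (p n t - p n s) /\<^sub>R (t - s) \<in>
        convex hull (X ` (ball (p n s) (h n + M * (h n + (t - s))) - S0))"
    by metis
  obtain y k where k: "strict_mono (k :: nat \<Rightarrow> nat)"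
    and unif: "\<And>e. 0 < e \<Longrightarrow> \<exists>N. \<forall>n t. n \<ge> N \<and> t \<in> {0..\<tau>} \<longrightarrow> norm (p (k n) t - y t) < e"
  proof (rule Arzela_Ascoli[of "{0..\<tau>}" p "norm x0 + M * \<tau>"])
    fix n t assume t: "t \<in> {0..\<tau>}"
    have "norm (p n t - p n 0) \<le> M * norm (t - 0)"
      using t \<tau>(1) by (intro lipschitz_on_normD[OF lip]) auto
    also have "\<dots> \<le> M * \<tau>"
      using t M by (intro mult_left_mono) auto
    finally show "norm (p n t) \<le> norm x0 + M * \<tau>"
      using norm_triangle_sub[of "p n t" "p n 0"] by (simp add: p0)
  next
    fix t e :: real assume t: "t \<in> {0..\<tau>}" and "0 < e"
    show "\<exists>d>0. \<forall>n s. s \<in> {0..\<tau>} \<and> norm (t - s) < d \<longrightarrow> norm (p n t - p n s) < e"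
    proof (intro exI[of _ "e / (M + 1)"] conjI allI impI; (elim conjE)?)
      fix n s assume s: "s \<in> {0..\<tau>}" "norm (t - s) < e / (M + 1)"
      have "norm (p n t - p n s) \<le> M * norm (t - s)"
        by (rule lipschitz_on_normD[OF lip t s(1)])
      also have "\<dots> \<le> (M + 1) * norm (t - s)"
        by (intro mult_right_mono) auto
      also have "\<dots> < e"
        using s(2) M by (simp add: pos_less_divide_eq mult.commute)
      finally show "norm (p n t - p n s) < e" .
    qed (use \<open>0 < e\<close> M in auto)
  qed (auto intro: that)
  have lim: "(\<lambda>n. p (k n) t) \<longlonglongrightarrow> y t" if "t \<in> {0..\<tau>}" for t
    unfolding LIMSEQ_iff using unif that by meson
  have h_lim: "(\<lambda>n. h (k n)) \<longlonglongrightarrow> 0"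
  proof -
    have "h \<longlonglongrightarrow> 0"
      unfolding h_def[abs_def] by (rule LIMSEQ_Suc[OF lim_const_over_n])
    from LIMSEQ_subseq_LIMSEQ[OF this k] show ?thesis
      by (simp add: o_def)
  qed
  have y0: "y 0 = x0"
    using lim[of 0] \<tau>(1) by (simp add: p0 LIMSEQ_const_iff)
  have lip_y: "M-lipschitz_on {0..\<tau>} y"
  proof (rule lipschitz_onI)
    fix s t assume st: "s \<in> {0..\<tau>}" "t \<in> {0..\<tau>}"
    have "(\<lambda>n. dist (p (k n) s) (p (k n) t)) \<longlonglongrightarrow> dist (y s) (y t)"
      by (intro tendsto_dist lim st)
    then show "dist (y s) (y t) \<le> M * dist s t"
      by (rule LIMSEQ_le_const2) (use lipschitz_onD[OF lip st] in auto)
  qed (fact M)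
  have slope_y: "(y t - y s) /\<^sub>R (t - s) \<in> closure (convex hull (X ` (ball (y s) \<delta> - S0)))"
    if st: "s \<in> {0..\<tau>}" "t \<in> {0..\<tau>}" "s < t" and \<delta>: "M * (t - s) < \<delta>" for s t \<delta>
  proof (rule Lim_in_closed_set[OF closed_closure _ sequentially_bot])
    show "(\<lambda>n. (p (k n) t - p (k n) s) /\<^sub>R (t - s)) \<longlonglongrightarrow> (y t - y s) /\<^sub>R (t - s)"
      by (intro tendsto_intros lim st)
    have "(\<lambda>n. dist (y s) (p (k n) s) + (h (k n) + M * (h (k n) + (t - s)))) \<longlonglongrightarrow>
        dist (y s) (y s) + (0 + M * (0 + (t - s)))"
      by (intro tendsto_intros lim st h_lim)
    then have "\<forall>\<^sub>F n in sequentially. dist (y s) (p (k n) s) + (h (k n) + M * (h (k n) + (t - s))) < \<delta>"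
      using \<delta> by (intro order_tendstoD) auto
    then show "\<forall>\<^sub>F n in sequentially. (p (k n) t - p (k n) s) /\<^sub>R (t - s) \<in>
        closure (convex hull (X ` (ball (y s) \<delta> - S0)))"
    proof (rule eventually_mono)
      fix n assume n: "dist (y s) (p (k n) s) + (h (k n) + M * (h (k n) + (t - s))) < \<delta>"
      have "ball (p (k n) s) (h (k n) + M * (h (k n) + (t - s))) \<subseteq> ball (y s) \<delta>"
      proof
        fix z assume "z \<in> ball (p (k n) s) (h (k n) + M * (h (k n) + (t - s)))"
        then show "z \<in> ball (y s) \<delta>"
          using n dist_triangle[of "y s" z "p (k n) s"] by simp
      qed
      then have "convex hull (X ` (ball (p (k n) s) (h (k n) + M * (h (k n) + (t - s))) - S0)) \<subseteq>
          convex hull (X ` (ball (y s) \<delta> - S0))"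
        by (intro hull_mono image_mono Diff_mono) auto
      then show "(p (k n) t - p (k n) s) /\<^sub>R (t - s) \<in> closure (convex hull (X ` (ball (y s) \<delta> - S0)))"
        using slope[OF st, of "k n"] closure_subset by blast
    qed
  qed
  have incl: "v \<in> filippov X (y t)"
    if t: "t \<in> {0..\<tau>}" and v: "(y has_vector_derivative v) (at t within {0..\<tau>})" for t v
  proof (rule filippov_if_generic)
    have "dist x0 (y t) \<le> M * \<tau>"
    proof -
      have "dist (y 0) (y t) \<le> M * dist 0 t"
        using t \<tau>(1) by (intro lipschitz_onD[OF lip_y]) auto
      also have "\<dots> \<le> M * \<tau>"
        using t M by (intro mult_left_mono) auto
      finally show ?thesis by (simp add: y0)
    qed
    then have "dist x0 (y t) < r"
      using \<tau> by (simp add: algebra_simps)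
    then show "0 < r - dist x0 (y t)" by simp
    show "isCont X z" if "z \<in> ball (y t) (r - dist x0 (y t)) - S0" for z
      using that dist_triangle[of x0 z "y t"] by (intro cont[rule_format]) auto
    fix \<delta> :: real assume "0 < \<delta>"
    show "v \<in> closure (convex hull (X ` (ball (y t) \<delta> - S0)))"
    proof (rule derivative_in_closed_slopes[OF closed_closure v])
      show "t islimpt {0..\<tau>}"
        using t \<tau>(1) by (simp add: islimpt_Icc)
      show "0 < \<delta> / (2 * (M + 1))"
        using \<open>0 < \<delta>\<close> M by simp
      fix s assume s: "s \<in> {0..\<tau>}" "s \<noteq> t" "\<bar>s - t\<bar> < \<delta> / (2 * (M + 1))"
      have "M * \<bar>s - t\<bar> \<le> (M + 1) * \<bar>s - t\<bar>"
        by (intro mult_right_mono) auto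
      also have "\<dots> < \<delta> / 2"
        using s(3) M by (simp add: field_simps)
      finally have close: "M * \<bar>s - t\<bar> < \<delta> / 2" .
      show "(y s - y t) /\<^sub>R (s - t) \<in> closure (convex hull (X ` (ball (y t) \<delta> - S0)))"
      proof (cases "t < s")
        case True
        then show ?thesis
          using slope_y[OF t s(1) True, of \<delta>] close \<open>0 < \<delta>\<close> by simp
      next
        case False
        then have "s < t" using s(2) by simp
        have "ball (y s) (\<delta> / 2) \<subseteq> ball (y t) \<delta>"
        proof
          fix z assume "z \<in> ball (y s) (\<delta> / 2)"
          moreover have "dist (y t) (y s) \<le> M * \<bar>s - t\<bar>"
            using lipschitz_onD[OF lip_y t s(1)] by (simp add: dist_real_def abs_minus_commute)
          ultimately show "z \<in> ball (y t) \<delta>"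
            using close dist_triangle[of "y t" z "y s"] by simp
        qed
        then have "closure (convex hull (X ` (ball (y s) (\<delta> / 2) - S0))) \<subseteq>
            closure (convex hull (X ` (ball (y t) \<delta> - S0)))"
          by (intro closure_mono hull_mono image_mono Diff_mono) auto
        moreover have "(y t - y s) /\<^sub>R (t - s) \<in> closure (convex hull (X ` (ball (y s) (\<delta> / 2) - S0)))"
          using slope_y[OF s(1) t \<open>s < t\<close>, of "\<delta> / 2"] close \<open>s < t\<close> by simp
        moreover have "(y s - y t) /\<^sub>R (s - t) = (y t - y s) /\<^sub>R (t - s)"
        proof -
          have "inverse (s - t) = - inverse (t - s)"
            by (metis inverse_minus_eq minus_diff_eq)
          then show ?thesis
            by (simp add: scaleR_diff_right)
        qed
        ultimately show ?thesis by auto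
      qed
    qed
  qed
  show thesis
  proof (rule that[OF \<tau>(1) y0 lip_y])
    show "negligible {t \<in> {0..\<tau>}. \<not> (\<exists>v\<in>filippov X (y t). (y has_vector_derivative v) (at t within {0..\<tau>}))}"
      by (rule negligible_subset[OF lipschitz_differentiable_ae[OF lip_y]]) (use incl in blast)
  qed
qed

section \<open>The transition matrix\<close>

text \<open>By the double-angle formula this is \<open>(a / 2) * cot (a / 2)\<close>, extended by
  \<open>1\<close> at \<open>0\<close>. Between \<open>0\<close> and \<open>2 * pi\<close> it is
  positive exactly below \<open>pi\<close>, which is why states are kept within that radius.\<close>

definition rot_coeff :: "real \<Rightarrow> real" where
  "rot_coeff a = sinc a / (sinc (a / 2))\<^sup>2"

lemma sinc_pos: "\<bar>a\<bar> < pi \<Longrightarrow> 0 < sinc a"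
  using sin_gt_zero[of a] sin_gt_zero[of "- a"]
  by (cases a "0 :: real" rule: linorder_cases) (auto simp: divide_pos_pos divide_neg_neg)

lemma isCont_rot_coeff:
  assumes "\<bar>a\<bar> < 2 * pi"
  shows "isCont rot_coeff a"
proof -
  have "isCont (\<lambda>a. sinc (a / 2)) a"
    by (rule isCont_o2[OF _ isCont_sinc]) (auto intro!: continuous_intros)
  moreover have "0 < sinc (a / 2)"
    by (rule sinc_pos) (use assms in simp)
  then have "(sinc (a / 2))\<^sup>2 \<noteq> 0"
    by (simp only: zero_eq_power2 less_imp_neq[symmetric] not_False_eq_True)
  ultimately show ?thesis
    unfolding rot_coeff_def[abs_def] by (intro isCont_divide isCont_power isCont_sinc)
qed

lemma rot_coeff_pos: "\<bar>a\<bar> < pi \<Longrightarrow> 0 < rot_coeff a"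
  unfolding rot_coeff_def using sinc_pos[of a] sinc_pos[of "a / 2"]
  by (intro divide_pos_pos zero_less_power) (auto simp: abs_if split: if_splits)

lemma rot_coeff_0: "rot_coeff 0 = 1"
  by (simp add: rot_coeff_def)

text \<open>The formula covers \<open>y = 0\<close> as well: the rank-one term vanishes there and
  the coefficient of the identity is \<open>1\<close>.\<close>

lemma transition_matrix_eq:
  "transition_matrix y = rot_coeff (norm y) *\<^sub>R mat 1
      + ((1 - rot_coeff (norm y)) / (norm y)\<^sup>2) *\<^sub>R (\<chi> k l. y $ k * y $ l) + (1 / 2) *\<^sub>R hat y"
proof (cases "y = 0")
  case True
  have "hat 0 = 0"
    by (simp add: hat_def vec_eq_iff forall_3)
  then show ?thesis
    using True by (simp add: transition_matrix_def rot_coeff_0)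
next
  case False
  then show ?thesis
    unfolding transition_matrix_def Let_def rot_coeff_def by simp
qed

lemma hat_mult_vec: "hat p *v w = cross3 p w"
  by (simp add: hat_def matrix_vector_mult_def cross3_def vec_eq_iff forall_3 sum_3 algebra_simps)

lemma transition_matrix_mult_vec:
  "transition_matrix y *v w = rot_coeff (norm y) *\<^sub>R w
      + ((1 - rot_coeff (norm y)) / (norm y)\<^sup>2 * (y \<bullet> w)) *\<^sub>R y + (1 / 2) *\<^sub>R cross3 y w"
proof -
  have "(\<chi> k l. y $ k * y $ l) *v w = (y \<bullet> w) *\<^sub>R y"
    by (simp add: matrix_vector_mult_def vec_eq_iff inner_vec_def sum_distrib_left mult_ac)
  then show ?thesis
    by (simp add: transition_matrix_eq matrix_vector_mult_add_rdistrib scaleR_matrix_vector_assoc[symmetric] hat_mult_vec)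
qed

lemma tendsto_matrix_vector_mult:
  fixes A :: "'b \<Rightarrow> real^'n^'m"
  assumes "(A \<longlongrightarrow> B) F" "(v \<longlongrightarrow> w) F"
  shows "((\<lambda>t. A t *v v t) \<longlongrightarrow> B *v w) F"
  unfolding matrix_vector_mult_def using assms by (intro vec_tendstoI) (auto intro!: tendsto_intros)

lemma tendsto_transpose:
  fixes A :: "'b \<Rightarrow> real^'n^'m"
  assumes "(A \<longlongrightarrow> B) F"
  shows "((\<lambda>t. transpose (A t)) \<longlongrightarrow> transpose B) F"
  unfolding transpose_def using assms by (intro vec_tendstoI) (auto intro!: tendsto_intros)

lemma tendsto_hat: "(hat \<longlongrightarrow> hat y) (at y)"
proof -
  have "((\<lambda>y. hat y $ i $ j) \<longlongrightarrow> hat y $ i $ j) (at y)" for i j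
    using exhaust_3[of i] exhaust_3[of j] by (elim disjE; simp add: hat_def; intro tendsto_intros)
  then show ?thesis
    by (intro vec_tendstoI) auto
qed

text \<open>At the origin the rank-one term is bounded by \<open>1 - rot_coeff (norm y)\<close> in
  absolute value, which tends to \<open>0\<close>.\<close>

lemma isCont_transition_matrix:
  assumes "norm y < 2 * pi"
  shows "isCont transition_matrix y"
proof -
  let ?c = "\<lambda>y :: real^3. rot_coeff (norm y)"
  let ?O = "\<lambda>y :: real^3. (\<chi> k l. y $ k * y $ l) :: real^3^3"
  have c: "(?c \<longlongrightarrow> ?c y) (at y)"
    by (rule isCont_tendsto_compose[OF isCont_rot_coeff]) (use assms in \<open>auto intro!: tendsto_intros\<close>)
  have "((\<lambda>y. ((1 - ?c y) / (norm y)\<^sup>2) *\<^sub>R ?O y) \<longlongrightarrow> ((1 - ?c y) / (norm y)\<^sup>2) *\<^sub>R ?O y) (at y)"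
  proof (cases "y = 0")
    case False
    have "(?O \<longlongrightarrow> ?O y) (at y)"
      by (intro vec_tendstoI) (auto intro!: tendsto_intros)
    with False c show ?thesis
      by (intro tendsto_intros) auto
  next
    case True
    have "((\<lambda>y. ((1 - ?c y) / (norm y)\<^sup>2) * (y $ k * y $ l)) \<longlongrightarrow> 0) (at y)" for k l
    proof (rule Lim_null_comparison)
      have "\<bar>(1 - ?c z) / (norm z)\<^sup>2 * (z $ k * z $ l)\<bar> \<le> \<bar>1 - ?c z\<bar>" for z
      proof -
        have "\<bar>z $ k * z $ l\<bar> \<le> norm z * norm z"
          unfolding abs_mult by (intro mult_mono component_le_norm_cart) auto
        then have "\<bar>1 - ?c z\<bar> / (norm z)\<^sup>2 * \<bar>z $ k * z $ l\<bar> \<le> \<bar>1 - ?c z\<bar> / (norm z)\<^sup>2 * (norm z)\<^sup>2"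
          by (intro mult_left_mono) (auto simp: power2_eq_square)
        also have "\<dots> \<le> \<bar>1 - ?c z\<bar>"
          by simp
        finally show ?thesis
          by (simp add: abs_mult)
      qed
      then show "\<forall>\<^sub>F z in at y. norm ((1 - ?c z) / (norm z)\<^sup>2 * (z $ k * z $ l)) \<le> \<bar>1 - ?c z\<bar>"
        by simp
      have "((\<lambda>z. \<bar>1 - ?c z\<bar>) \<longlongrightarrow> \<bar>1 - ?c y\<bar>) (at y)"
        by (intro tendsto_intros c)
      then show "((\<lambda>z. \<bar>1 - ?c z\<bar>) \<longlongrightarrow> 0) (at y)"
        using True by (simp add: rot_coeff_0)
    qed
    then show ?thesis
      using True by (intro vec_tendstoI) auto
  qed
  from tendsto_add[OF tendsto_add[OF tendsto_scaleR[OF c tendsto_const[of "mat 1"]] this]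
      tendsto_scaleR[OF tendsto_const[of "1 / 2"] tendsto_hat]]
  show ?thesis
    unfolding isCont_def transition_matrix_eq .
qed

text \<open>In the direction of \<open>y\<close> the coefficients of the identity and of the
  rank-one term add up to \<open>1\<close>, and the cross product is orthogonal to
  \<open>y\<close>.\<close>

lemma inner_transition_matrix: "y \<bullet> (transition_matrix y *v w) = y \<bullet> w"
proof (cases "y = 0")
  case False
  then show ?thesis
    by (simp add: transition_matrix_mult_vec inner_add_right dot_cross_self dot_square_norm field_simps)
qed simp

text \<open>The skew part does not contribute to \<open>w \<bullet> L w\<close>. The symmetric part
  has eigenvalue \<open>1\<close> along \<open>y\<close> and \<open>rot_coeff (norm y)\<close> on
  the orthogonal complement, and the latter has a positive minimum on \<open>{0..r}\<close>.\<close>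

lemma transition_matrix_coercive:
  assumes "r < pi"
  obtains \<gamma> where "0 < \<gamma>" "\<And>y w. norm y \<le> r \<Longrightarrow> \<gamma> * (norm w)\<^sup>2 \<le> w \<bullet> (transition_matrix y *v w)"
proof (cases "0 \<le> r")
  case True
  have "continuous_on {0..r} rot_coeff"
    using assms True by (intro continuous_at_imp_continuous_on ballI isCont_rot_coeff) auto
  then obtain a where a: "a \<in> {0..r}" "\<And>b. b \<in> {0..r} \<Longrightarrow> rot_coeff a \<le> rot_coeff b"
    using continuous_attains_inf[of "{0..r}" rot_coeff] True by auto
  define \<gamma> where "\<gamma> = min 1 (rot_coeff a)"
  show thesis
  proof (rule that)
    show "0 < \<gamma>"
      using rot_coeff_pos[of a] a(1) assms by (auto simp: \<gamma>_def)
    fix y w :: "real^3" assume y: "norm y \<le> r"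
    define c p where "c = rot_coeff (norm y)" and "p = (y \<bullet> w)\<^sup>2 / (norm y)\<^sup>2"
    have p: "0 \<le> p" "p \<le> (norm w)\<^sup>2"
    proof -
      have "(y \<bullet> w)\<^sup>2 \<le> (norm y)\<^sup>2 * (norm w)\<^sup>2"
        using Cauchy_Schwarz_ineq[of y w] by (simp add: dot_square_norm)
      then show "p \<le> (norm w)\<^sup>2"
        unfolding p_def by (cases "y = 0") (auto simp: pos_divide_le_eq mult.commute)
    qed (simp add: p_def)
    have "\<gamma> \<le> c" "\<gamma> \<le> 1"
      using a(2)[of "norm y"] y by (auto simp: \<gamma>_def c_def)
    then have "\<gamma> * ((norm w)\<^sup>2 - p) + \<gamma> * p \<le> c * ((norm w)\<^sup>2 - p) + 1 * p"
      using p by (intro add_mono mult_right_mono) auto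
    also have "\<dots> = c * (w \<bullet> w) + (1 - c) / (norm y)\<^sup>2 * (y \<bullet> w) * (w \<bullet> y)"
      by (simp add: p_def dot_square_norm inner_commute power2_eq_square algebra_simps diff_divide_distrib)
    also have "\<dots> = w \<bullet> (transition_matrix y *v w)"
      by (simp add: transition_matrix_mult_vec inner_add_right dot_cross_self c_def)
    finally show "\<gamma> * (norm w)\<^sup>2 \<le> w \<bullet> (transition_matrix y *v w)"
      by (simp add: algebra_simps)
  qed
next
  case False
  show thesis
  proof (rule that[of 1])
    fix y w :: "real^3" assume "norm y \<le> r"
    then have False using False norm_ge_zero[of y] by linarith
    then show "1 * (norm w)\<^sup>2 \<le> w \<bullet> (transition_matrix y *v w)" ..
  qed simp
qed

lemma transition_matrix_bounded:
  assumes "r < 2 * pi"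
  obtains \<Lambda> where "0 \<le> \<Lambda>" "\<And>y w. norm y \<le> r \<Longrightarrow> norm (transition_matrix y *v w) \<le> \<Lambda> * norm w"
proof -
  have "continuous_on {0..r} rot_coeff"
    using assms by (intro continuous_at_imp_continuous_on ballI isCont_rot_coeff) auto
  then have "bounded (rot_coeff ` {0..r})"
    by (intro compact_imp_bounded compact_continuous_image) auto
  then obtain B where "\<forall>z\<in>rot_coeff ` {0..r}. norm z \<le> B"
    unfolding bounded_iff by blast
  then have B: "\<bar>rot_coeff a\<bar> \<le> B" if "a \<in> {0..r}" for a
    using that by auto
  show thesis
  proof (rule that[of "\<bar>B\<bar> + (1 + \<bar>B\<bar>) + \<bar>r\<bar> / 2"])
    fix y w :: "real^3" assume y: "norm y \<le> r"
    let ?c = "rot_coeff (norm y)"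
    have c: "\<bar>?c\<bar> \<le> \<bar>B\<bar>"
      using B[of "norm y"] y by auto
    have "norm (?c *\<^sub>R w) \<le> \<bar>B\<bar> * norm w"
      using c by (auto intro: mult_right_mono)
    moreover have "norm (((1 - ?c) / (norm y)\<^sup>2 * (y \<bullet> w)) *\<^sub>R y) \<le> (1 + \<bar>B\<bar>) * norm w"
    proof -
      have "norm (((1 - ?c) / (norm y)\<^sup>2 * (y \<bullet> w)) *\<^sub>R y) = \<bar>1 - ?c\<bar> / (norm y)\<^sup>2 * (\<bar>y \<bullet> w\<bar> * norm y)"
        by (simp add: abs_mult)
      also have "\<dots> \<le> \<bar>1 - ?c\<bar> / (norm y)\<^sup>2 * ((norm y * norm w) * norm y)"
        by (intro mult_left_mono mult_right_mono Cauchy_Schwarz_ineq2) auto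
      also have "\<dots> \<le> \<bar>1 - ?c\<bar> * norm w"
        by (cases "y = 0") (auto simp: power2_eq_square)
      also have "\<dots> \<le> (1 + \<bar>B\<bar>) * norm w"
        using c by (intro mult_right_mono) auto
      finally show ?thesis .
    qed
    moreover have "norm ((1 / 2) *\<^sub>R cross3 y w) \<le> \<bar>r\<bar> / 2 * norm w"
    proof -
      have "(norm (cross3 y w))\<^sup>2 \<le> (norm y * norm w)\<^sup>2"
        using norm_cross_dot[of y w] zero_le_power2[of "y \<bullet> w"] by linarith
      then have "norm (cross3 y w) \<le> norm y * norm w"
        by (simp add: power2_le_iff_abs_le)
      also have "\<dots> \<le> \<bar>r\<bar> * norm w"
        using y by (intro mult_right_mono) auto
      finally show ?thesis by simp
    qed
    ultimately show "norm (transition_matrix y *v w) \<le> (\<bar>B\<bar> + (1 + \<bar>B\<bar>) + \<bar>r\<bar> / 2) * norm w"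
      unfolding transition_matrix_mult_vec distrib_right by (intro norm_triangle_le add_mono) 
  qed auto
qed

section \<open>The disagreement function and its subgradients\<close>

definition disagreement :: "'n::finite set set \<Rightarrow> real^3^'n \<Rightarrow> real" where
  "disagreement E x = (\<Sum>i\<in>UNIV. \<Sum>j\<in>neighbours E i. \<Sum>k\<in>UNIV. \<bar>x $ j $ k - x $ i $ k\<bar>) / 2"

text \<open>The negative of \<open>\<omega>\<close> is a subgradient of the convex function
  \<open>disagreement E\<close> at \<open>x\<close>.\<close>

definition descent :: "'n::finite set set \<Rightarrow> real^3^'n \<Rightarrow> real^3^'n \<Rightarrow> bool" where
  "descent E x \<omega> \<longleftrightarrow> (\<forall>y. disagreement E x - \<omega> \<bullet> (y - x) \<le> disagreement E y)"

lemma sum_neighbours_swap: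
  fixes F :: "'n::finite \<Rightarrow> 'n \<Rightarrow> real"
  shows "(\<Sum>i\<in>UNIV. \<Sum>j\<in>neighbours E i. F i j) = (\<Sum>i\<in>UNIV. \<Sum>j\<in>neighbours E i. F j i)"
  using sum.swap_restrict[of UNIV UNIV F "\<lambda>i j. {i, j} \<in> E"]
  by (simp add: neighbours_def insert_commute)

text \<open>Each sign is a subgradient of the absolute value. Since edges are symmetric, the
  resulting sum over ordered pairs is minus twice the pairing with the controller.\<close>

lemma descent_controller: "descent E x (\<chi> i. controller E x i)"
  unfolding descent_def
proof
  fix y
  let ?d = "y - x"
  let ?s = "\<lambda>i j k. sgn (x $ j $ k - x $ i $ k)"
  let ?A = "\<Sum>i\<in>UNIV. \<Sum>j\<in>neighbours E i. \<Sum>k\<in>UNIV. ?s i j k * ?d $ i $ k"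
  let ?B = "\<Sum>i\<in>UNIV. \<Sum>j\<in>neighbours E i. \<Sum>k\<in>UNIV. ?s i j k * ?d $ j $ k"
  have A: "(\<chi> i. controller E x i) \<bullet> ?d = ?A"
  proof -
    have "controller E x i \<bullet> ?d $ i = (\<Sum>j\<in>neighbours E i. \<Sum>k\<in>UNIV. ?s i j k * ?d $ i $ k)" for i
      unfolding controller_def inner_sum_left by (simp add: vsign_def inner_vec_def)
    then show ?thesis
      by (simp add: inner_vec_def[of "\<chi> i. controller E x i"])
  qed
  have "?B = (\<Sum>i\<in>UNIV. \<Sum>j\<in>neighbours E i. \<Sum>k\<in>UNIV. ?s j i k * ?d $ i $ k)"
    by (rule sum_neighbours_swap)
  also have "\<dots> = (\<Sum>i\<in>UNIV. \<Sum>j\<in>neighbours E i. \<Sum>k\<in>UNIV. - (?s i j k * ?d $ i $ k))"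
    by (intro sum.cong refl) (simp add: sgn_if)
  finally have B: "?B = - ?A"
    by (simp add: sum_negf)
  have "(\<Sum>i\<in>UNIV. \<Sum>j\<in>neighbours E i. \<Sum>k\<in>UNIV. \<bar>x $ j $ k - x $ i $ k\<bar>) + (?B - ?A) \<le>
      (\<Sum>i\<in>UNIV. \<Sum>j\<in>neighbours E i. \<Sum>k\<in>UNIV. \<bar>y $ j $ k - y $ i $ k\<bar>)"
    unfolding sum.distrib[symmetric] sum_subtractf[symmetric]
    by (intro sum_mono) (auto simp: sgn_if abs_if algebra_simps)
  then show "disagreement E x - (\<chi> i. controller E x i) \<bullet> ?d \<le> disagreement E y"
    unfolding disagreement_def A B by (simp add: field_simps)
qed

lemma disagreement_nonneg: "0 \<le> disagreement E x"
  by (simp add: disagreement_def sum_nonneg)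

lemma disagreement_scaleR: "disagreement E (c *\<^sub>R x) = \<bar>c\<bar> * disagreement E x"
  by (simp add: disagreement_def right_diff_distrib[symmetric] abs_mult sum_distrib_left)

lemma disagreement_translate: "disagreement E (x + (\<chi> i. a)) = disagreement E x"
  by (simp add: disagreement_def)

lemma disagreement_lipschitz:
  obtains C where "C-lipschitz_on UNIV (disagreement E)"
proof
  let ?C = "\<Sum>i\<in>UNIV. \<Sum>j\<in>neighbours E i. \<Sum>k\<in>(UNIV :: 3 set). 1 :: real"
  have le: "disagreement E x - disagreement E y \<le> ?C * norm (x - y)" for x y
  proof -
    have comp: "\<bar>x $ i $ k - y $ i $ k\<bar> \<le> norm (x - y)" for i k
    proof -
      have "\<bar>(x - y) $ i $ k\<bar> \<le> norm (x - y)"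
        by (rule order_trans[OF component_le_norm_cart Finite_Cartesian_Product.norm_nth_le])
      then show ?thesis by simp
    qed
    have "\<bar>x $ j $ k - x $ i $ k\<bar> \<le> \<bar>y $ j $ k - y $ i $ k\<bar> + 2 * norm (x - y)" for i j k
      using comp[of i k] comp[of j k] by linarith
    then have "(\<Sum>i\<in>UNIV. \<Sum>j\<in>neighbours E i. \<Sum>k\<in>UNIV. \<bar>x $ j $ k - x $ i $ k\<bar>)
        \<le> (\<Sum>i\<in>UNIV. \<Sum>j\<in>neighbours E i. \<Sum>k\<in>UNIV. \<bar>y $ j $ k - y $ i $ k\<bar> + 2 * norm (x - y))"
      by (intro sum_mono)
    also have "\<dots> = (\<Sum>i\<in>UNIV. \<Sum>j\<in>neighbours E i. \<Sum>k\<in>UNIV. \<bar>y $ j $ k - y $ i $ k\<bar>)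
        + ?C * (2 * norm (x - y))"
      by (simp add: sum.distrib sum_distrib_left sum_distrib_right mult_ac)
    finally show ?thesis
      by (simp add: disagreement_def)
  qed
  show "?C-lipschitz_on UNIV (disagreement E)"
  proof (rule lipschitz_onI)
    show "dist (disagreement E x) (disagreement E y) \<le> ?C * dist x y" for x y
      using le[of x y] le[of y x] by (simp add: dist_norm norm_minus_commute abs_le_iff)
  qed (simp add: sum_nonneg)
qed

lemma descent_norm_le:
  assumes C: "C-lipschitz_on UNIV (disagreement E)" and "descent E x \<omega>"
  shows "norm \<omega> \<le> C"
proof -
  have "disagreement E x - \<omega> \<bullet> ((x - \<omega>) - x) \<le> disagreement E (x - \<omega>)"
    using assms(2) unfolding descent_def by blast
  moreover have "disagreement E (x - \<omega>) - disagreement E x \<le> C * norm \<omega>"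
    using lipschitz_on_normD[OF C, of "x - \<omega>" x] by (simp add: abs_le_iff)
  ultimately have "norm \<omega> * norm \<omega> \<le> C * norm \<omega>"
    by (simp add: dot_square_norm power2_eq_square)
  then show ?thesis
    using lipschitz_on_nonneg[OF C] by (cases "\<omega> = 0") auto
qed

text \<open>Euler's identity for positively homogeneous functions, from the test points
  \<open>0\<close> and \<open>2 *\<^sub>R x\<close>.\<close>

lemma descent_inner_self:
  assumes "descent E x \<omega>"
  shows "\<omega> \<bullet> x = - disagreement E x"
proof -
  have "disagreement E x - \<omega> \<bullet> (0 - x) \<le> disagreement E 0"
    using assms unfolding descent_def by blast
  moreover have "disagreement E x - \<omega> \<bullet> (2 *\<^sub>R x - x) \<le> disagreement E (2 *\<^sub>R x)"
    using assms unfolding descent_def by blast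
  ultimately show ?thesis
    using disagreement_scaleR[of E 0 x] by (simp add: disagreement_scaleR inner_diff_right)
qed

lemma descent_inner_diagonal:
  fixes x \<omega> :: "real^3^'n::finite"
  assumes "descent E x \<omega>"
  shows "\<omega> \<bullet> (\<chi> i. a) = 0"
proof -
  have "disagreement E x - \<omega> \<bullet> ((x + (\<chi> i. b)) - x) \<le> disagreement E (x + (\<chi> i. b))" for b
    using assms unfolding descent_def by blast
  then have nonneg: "0 \<le> \<omega> \<bullet> (\<chi> i. b)" for b
    by (simp add: disagreement_translate)
  have "(\<chi> i. - a) = - ((\<chi> i. a) :: real^3^'n)"
    by (simp add: vec_eq_iff)
  then show ?thesis
    using nonneg[of a] nonneg[of "- a"] by (simp only: inner_minus_right)
qed

lemma descent_sum_zero: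
  assumes "descent E x \<omega>"
  shows "(\<Sum>i\<in>UNIV. \<omega> $ i) = 0"
proof -
  have "(\<Sum>i\<in>UNIV. \<omega> $ i) \<bullet> (\<Sum>i\<in>UNIV. \<omega> $ i) = \<omega> \<bullet> (\<chi> j. \<Sum>i\<in>UNIV. \<omega> $ i)"
    by (simp add: inner_vec_def[of \<omega>] inner_sum_left)
  also have "\<dots> = 0"
    by (rule descent_inner_diagonal[OF assms])
  finally show ?thesis by simp
qed

text \<open>Along a path between two nodes the differences over its edges add up.\<close>

lemma connected_disagreement_bound:
  fixes E :: "'n::finite set set"
  assumes conn: "connected_graph E"
  obtains K where "0 < K" "\<And>x i j. norm (x $ j - x $ i) \<le> K * disagreement E x"
proof -
  have edge: "norm (x $ j - x $ i) \<le> 2 * disagreement E x" if "j \<in> neighbours E i" for x i j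
  proof -
    let ?t = "\<lambda>i j. \<Sum>k\<in>UNIV. \<bar>x $ j $ k - x $ i $ k\<bar>"
    have "norm (x $ j - x $ i) \<le> ?t i j"
      using norm_le_l1_cart[of "x $ j - x $ i"] by simp
    also have "\<dots> \<le> (\<Sum>j\<in>neighbours E i. ?t i j)"
      using that by (intro member_le_sum) (auto intro: sum_nonneg)
    also have "\<dots> \<le> (\<Sum>i\<in>UNIV. \<Sum>j\<in>neighbours E i. ?t i j)"
      by (intro member_le_sum[where f = "\<lambda>i. \<Sum>j\<in>neighbours E i. ?t i j"]) (auto intro!: sum_nonneg)
    finally show ?thesis
      by (simp add: disagreement_def)
  qed
  have "\<exists>K\<ge>0. \<forall>x. norm (x $ j - x $ i) \<le> K * disagreement E x" for i j
  proof -
    have "(i, j) \<in> {(u, v). v \<in> neighbours E u}\<^sup>*"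
      using conn unfolding connected_graph_def by blast
    then show ?thesis
    proof (induction rule: rtrancl_induct)
      case base
      show ?case by (intro exI[of _ 0]) simp
    next
      case (step u v)
      then obtain K where K: "K \<ge> 0" "\<And>x. norm (x $ u - x $ i) \<le> K * disagreement E x"
        by blast
      have "norm (x $ v - x $ i) \<le> (K + 2) * disagreement E x" for x
        using K(2)[of x] edge[of v u x] step(2) norm_triangle_ineq[of "x $ u - x $ i" "x $ v - x $ u"]
        by (simp add: algebra_simps)
      then show ?case
        using K(1) by (intro exI[of _ "K + 2"]) auto
    qed
  qed
  then have "\<forall>i. \<exists>K. \<forall>j. 0 \<le> K j \<and> (\<forall>x. norm (x $ j - x $ i) \<le> K j * disagreement E x)"
    by (intro allI choice) blast
  then obtain K where K: "\<And>i j. 0 \<le> K i j" "\<And>i j x. norm (x $ j - x $ i) \<le> K i j * disagreement E x"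
    using choice[of "\<lambda>i K. \<forall>j. 0 \<le> K j \<and> (\<forall>x. norm (x $ j - x $ i) \<le> K j * disagreement E x)"] by blast
  show thesis
  proof (rule that[of "1 + (\<Sum>i\<in>UNIV. \<Sum>j\<in>UNIV. K i j)"])
    show "0 < 1 + (\<Sum>i\<in>UNIV. \<Sum>j\<in>UNIV. K i j)"
      using K(1) by (intro add_pos_nonneg sum_nonneg) auto
    fix x :: "real^3^'n" and i j
    have "K i j \<le> (\<Sum>j\<in>UNIV. K i j)"
      using K(1) by (intro member_le_sum) auto
    also have "\<dots> \<le> (\<Sum>i\<in>UNIV. \<Sum>j\<in>UNIV. K i j)"
      using K(1) by (intro member_le_sum[where f = "\<lambda>i. \<Sum>j\<in>UNIV. K i j"]) (auto intro!: sum_nonneg)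
    finally have "K i j \<le> 1 + (\<Sum>i\<in>UNIV. \<Sum>j\<in>UNIV. K i j)"
      by simp
    then show "norm (x $ j - x $ i) \<le> (1 + (\<Sum>i\<in>UNIV. \<Sum>j\<in>UNIV. K i j)) * disagreement E x"
      using K(2)[of x j i] mult_right_mono[OF _ disagreement_nonneg] by (meson order_trans)
  qed
qed

text \<open>By homogeneity and translation invariance, the disagreement equals \<open>- (\<omega>
  \<bullet> (x - c))\<close> for every state \<open>c\<close> with equal blocks. If these are one of
  the blocks of \<open>x\<close>, the norm of \<open>x - c\<close> is at most a constant times the
  disagreement, which then cancels.\<close>

lemma descent_norm_bounded_below:
  fixes E :: "'n::finite set set"
  assumes conn: "connected_graph E"
  obtains \<kappa> where "0 < \<kappa>" "\<And>x \<omega>. descent E x \<omega> \<Longrightarrow> 0 < disagreement E x \<Longrightarrow> \<kappa> \<le> norm \<omega>"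
proof -
  obtain K where K: "0 < K" "\<And>x i j. norm (x $ j - x $ i) \<le> K * disagreement E x"
    using connected_disagreement_bound[OF conn] by metis
  let ?n = "real CARD('n)"
  show thesis
  proof (rule that)
    show "0 < 1 / (?n * K)"
      using K(1) by (simp add: zero_less_card_finite)
    fix x \<omega> assume \<omega>: "descent E x \<omega>" and pos: "0 < disagreement E x"
    define a where "a = x $ undefined"
    have "norm (x - (\<chi> i. a)) \<le> (\<Sum>i\<in>UNIV. norm (x $ i - a))"
      unfolding norm_vec_def[of "x - (\<chi> i. a)"] by (rule order_trans[OF L2_set_le_sum]) auto
    also have "\<dots> \<le> (\<Sum>i\<in>(UNIV :: 'n set). K * disagreement E x)"
      unfolding a_def by (intro sum_mono K(2))
    finally have dist_le: "norm (x - (\<chi> i. a)) \<le> ?n * K * disagreement E x"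
      by simp
    have "disagreement E x = - (\<omega> \<bullet> (x - (\<chi> i. a)))"
      using descent_inner_self[OF \<omega>] descent_inner_diagonal[OF \<omega>, of a] by (simp add: inner_diff_right)
    also have "\<dots> \<le> norm \<omega> * norm (x - (\<chi> i. a))"
      using Cauchy_Schwarz_ineq2[of \<omega> "x - (\<chi> i. a)"] by linarith
    also have "\<dots> \<le> norm \<omega> * (?n * K * disagreement E x)"
      by (rule mult_left_mono[OF dist_le norm_ge_zero])
    finally have "disagreement E x * 1 \<le> disagreement E x * (norm \<omega> * (?n * K))"
      by (simp only: mult_ac mult_1)
    then have "1 \<le> norm \<omega> * (?n * K)"
      using pos by (simp only: mult_le_cancel_left_pos)
    then show "1 / (?n * K) \<le> norm \<omega>"
      using K(1) by (simp add: pos_divide_le_eq zero_less_card_finite)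
  qed
qed

text \<open>The transition matrices at \<open>x\<close> are invertible, so \<open>\<omega>\<close>
  can be defined from \<open>v\<close>. Each subgradient inequality for \<open>\<omega>\<close> is a
  linear inequality for \<open>v\<close>, and it suffices to check it, up to an arbitrarily small
  error, for the values of the closed loop near \<open>x\<close>: half-spaces pass to closed convex
  hulls.\<close>

lemma filippov_closed_loop_descent:
  fixes x :: "real^3^'n::finite"
  assumes small: "\<forall>i. norm (x $ i) < pi" and v: "v \<in> filippov (closed_loop E) x"
  shows "\<exists>\<omega>. descent E x \<omega> \<and> v = (\<chi> i. transition_matrix (x $ i) *v \<omega> $ i)"
proof -
  let ?L = "\<lambda>z i. transition_matrix (z $ i) :: real^3^3"
  have "\<exists>B. B ** ?L x i = mat 1" for i
  proof -
    obtain \<gamma> where \<gamma>: "0 < \<gamma>" "\<And>y w. norm y \<le> norm (x $ i) \<Longrightarrow> \<gamma> * (norm w)\<^sup>2 \<le> w \<bullet> (transition_matrix y *v w)"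
      using transition_matrix_coercive[OF small[rule_format]] by metis
    have "w = 0" if "?L x i *v w = 0" for w
      using \<gamma>(1) \<gamma>(2)[of "x $ i" w] that by (simp add: mult_le_0_iff)
    then show ?thesis
      unfolding matrix_left_invertible_ker by blast
  qed
  then obtain B where BL: "\<And>i. B i ** ?L x i = mat 1"
    by metis
  then have LB: "\<And>i. ?L x i ** B i = mat 1"
    using matrix_left_right_inverse by blast
  define \<omega> where "\<omega> = (\<chi> i. B i *v v $ i)"
  have v_eq: "v = (\<chi> i. ?L x i *v \<omega> $ i)"
    by (simp add: \<omega>_def vec_eq_iff matrix_vector_mul_assoc LB)
  have adjoint: "u \<bullet> (transpose A *v p) = (A *v u) \<bullet> p" for A :: "real^3^3" and p u
    by (metis dot_lmul_matrix inner_commute transpose_matrix_vector)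
  obtain C where C: "C-lipschitz_on UNIV (disagreement E)"
    using disagreement_lipschitz by metis
  have "disagreement E x - \<omega> \<bullet> (y - x) \<le> disagreement E y" for y
  proof -
    define q where "q = (\<chi> i. transpose (B i) *v (y $ i - x $ i))"
    have vq: "v \<bullet> q = \<omega> \<bullet> (y - x)"
      unfolding inner_vec_def[of v] inner_vec_def[of \<omega>]
      by (simp add: q_def \<omega>_def adjoint del: transpose_matrix_vector)
    \<comment> \<open>a lower bound for \<open>closed_loop E z \<bullet> q\<close>, continuous in
      \<open>z\<close>, whose value at \<open>x\<close> is the desired one\<close>
    define g where "g z = disagreement E z - disagreement E y
        - C * (\<Sum>i\<in>UNIV. norm (transpose (?L z i) *v q $ i - (y $ i - z $ i)))" for z
    have "isCont g x"
    proof -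
      have "isCont (disagreement E) x"
        using lipschitz_on_continuous_on[OF C] by (simp add: continuous_on_eq_continuous_at)
      moreover have "isCont (\<lambda>z. transpose (?L z i) *v q $ i) x" for i
      proof -
        have "norm (x $ i) < 2 * pi"
          using small[rule_format, of i] pi_gt_zero by linarith
        then have "((\<lambda>z. ?L z i) \<longlongrightarrow> ?L x i) (at x)"
          by (intro isCont_tendsto_compose[OF isCont_transition_matrix] tendsto_vec_nth tendsto_ident_at)
        then show ?thesis
          unfolding isCont_def by (intro tendsto_matrix_vector_mult tendsto_transpose tendsto_const)
      qed
      ultimately show ?thesis
        unfolding g_def by (intro continuous_intros)
    qed
    have gx: "g x = disagreement E x - disagreement E y"
      by (simp add: g_def q_def matrix_vector_mul_assoc matrix_transpose_mul[symmetric] BL transpose_mat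
          del: transpose_matrix_vector)
    have "disagreement E x - disagreement E y \<le> v \<bullet> q"
    proof (rule field_le_epsilon)
      fix e :: real assume "0 < e"
      then obtain \<delta> where \<delta>: "\<delta> > 0" "\<And>z. dist z x < \<delta> \<Longrightarrow> dist (g z) (g x) < e"
        using \<open>isCont g x\<close> unfolding continuous_at_eps_delta by blast
      define H where "H = {u. g x - e \<le> q \<bullet> u}"
      have "closed_loop E z \<in> H" if "z \<in> ball x \<delta>" for z
      proof -
        let ?w = "\<chi> i. controller E z i"
        have "g z \<le> disagreement E z - disagreement E y
            + (\<Sum>i\<in>UNIV. controller E z i \<bullet> (transpose (?L z i) *v q $ i - (y $ i - z $ i)))"
        proof -
          have "- (C * norm p) \<le> controller E z i \<bullet> p" for i p
          proof -
            have "norm (controller E z i) \<le> norm ?w"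
              using Finite_Cartesian_Product.norm_nth_le[of ?w i] by simp
            also have "\<dots> \<le> C"
              by (rule descent_norm_le[OF C descent_controller])
            finally have "norm (controller E z i) * norm p \<le> C * norm p"
              by (intro mult_right_mono) auto
            then show ?thesis
              using Cauchy_Schwarz_ineq2[of "controller E z i" p] by linarith
          qed
          then have "(\<Sum>i\<in>UNIV. - (C * norm (transpose (?L z i) *v q $ i - (y $ i - z $ i)))) \<le>
              (\<Sum>i\<in>UNIV. controller E z i \<bullet> (transpose (?L z i) *v q $ i - (y $ i - z $ i)))"
            by (intro sum_mono)
          then show ?thesis
            by (simp add: g_def sum_negf sum_distrib_left)
        qed
        also have "\<dots> = disagreement E z - ?w \<bullet> (y - z) - disagreement E y + q \<bullet> closed_loop E z"
          unfolding inner_commute[of q] inner_vec_def[of ?w] inner_vec_def[of "closed_loop E z"]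
          by (simp add: closed_loop_def inner_diff_right sum_subtractf adjoint del: transpose_matrix_vector)
        also have "\<dots> \<le> q \<bullet> closed_loop E z"
          using descent_controller[of E z] unfolding descent_def by (simp add: algebra_simps)
        finally show ?thesis
          using \<delta>(2)[of z] that by (simp add: H_def dist_real_def dist_commute abs_less_iff)
      qed
      then have "convex hull (closed_loop E ` (ball x \<delta> - {})) \<subseteq> H"
        unfolding H_def by (intro hull_minimal convex_halfspace_ge) auto
      then have "closure (convex hull (closed_loop E ` (ball x \<delta> - {}))) \<subseteq> H"
        unfolding H_def by (intro closure_minimal closed_halfspace_ge)
      moreover have "v \<in> closure (convex hull (closed_loop E ` (ball x \<delta> - {})))"
        using v \<delta>(1) unfolding filippov_def by blast
      ultimately have "v \<in> H" by blast
      then show "disagreement E x - disagreement E y \<le> v \<bullet> q + e"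
        by (simp add: H_def gx inner_commute)
    qed
    then show ?thesis
      unfolding vq by simp
  qed
  then have "descent E x \<omega>"
    by (simp add: descent_def)
  with v_eq show ?thesis by blast
qed

section \<open>Decay along confined solutions\<close>

lemma norm_block_le:
  fixes x :: "real^3^'n::finite"
  shows "norm x \<le> (\<Sum>i\<in>UNIV. norm (x $ i))"
  unfolding norm_vec_def[of x] by (rule L2_set_le_sum) auto

lemma closed_loop_velocity_bound:
  fixes E :: "'n::finite set set"
  assumes "r < pi"
  shows "\<exists>M\<ge>0. \<forall>x \<omega>. norm x \<le> r \<longrightarrow> descent E x \<omega> \<longrightarrow>
    norm (\<chi> i. transition_matrix (x $ i) *v \<omega> $ i) \<le> M"
proof -
  have "r < 2 * pi"
    using assms pi_gt_zero by linarith
  then obtain \<Lambda> where \<Lambda>: "0 \<le> \<Lambda>" "\<And>y w. norm y \<le> r \<Longrightarrow> norm (transition_matrix y *v w) \<le> \<Lambda> * norm w"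
    using transition_matrix_bounded by metis
  obtain C where C: "C-lipschitz_on UNIV (disagreement E)"
    using disagreement_lipschitz by metis
  show ?thesis
  proof (intro exI[of _ "real CARD('n) * (\<Lambda> * C)"] conjI allI impI)
    show "0 \<le> real CARD('n) * (\<Lambda> * C)"
      using \<Lambda>(1) lipschitz_on_nonneg[OF C] by simp
    fix x \<omega> assume x: "norm x \<le> r" and \<omega>: "descent E x \<omega>"
    have "norm (\<chi> i. transition_matrix (x $ i) *v \<omega> $ i) \<le>
        (\<Sum>i\<in>UNIV. norm (transition_matrix (x $ i) *v \<omega> $ i))"
      using norm_block_le[of "\<chi> i. transition_matrix (x $ i) *v \<omega> $ i"] by simp
    also have "\<dots> \<le> (\<Sum>i\<in>(UNIV :: 'n set). \<Lambda> * C)"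
    proof (rule sum_mono)
      fix i
      have "norm (transition_matrix (x $ i) *v \<omega> $ i) \<le> \<Lambda> * norm (\<omega> $ i)"
        using Finite_Cartesian_Product.norm_nth_le[of x i] x by (intro \<Lambda>(2)) simp
      also have "\<dots> \<le> \<Lambda> * C"
        using Finite_Cartesian_Product.norm_nth_le[of \<omega> i] descent_norm_le[OF C \<omega>] \<Lambda>(1)
        by (intro mult_left_mono) simp_all
      finally show "norm (transition_matrix (x $ i) *v \<omega> $ i) \<le> \<Lambda> * C" .
    qed
    finally show "norm (\<chi> i. transition_matrix (x $ i) *v \<omega> $ i) \<le> real CARD('n) * (\<Lambda> * C)"
      by simp
  qed
qed

definition descends_at :: "'n::finite set set \<Rightarrow> real set \<Rightarrow> (real \<Rightarrow> real^3^'n) \<Rightarrow> real \<Rightarrow> bool" where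
  "descends_at E S x t \<longleftrightarrow> (\<exists>\<omega>. descent E (x t) \<omega> \<and>
     (x has_vector_derivative (\<chi> i. transition_matrix (x t $ i) *v \<omega> $ i)) (at t within S))"

text \<open>A Lipschitz solution in the ball of radius \<open>r\<close>, with its velocities already
  written through descent directions. Unlike \<open>filippov_solution\<close> it is meant for
  arbitrary time intervals, since the decay of the disagreement is integrated over
  subintervals.\<close>

definition confined_solution ::
  "'n::finite set set \<Rightarrow> real \<Rightarrow> real \<Rightarrow> real \<Rightarrow> (real \<Rightarrow> real^3^'n) \<Rightarrow> bool" where
  "confined_solution E r a b x \<longleftrightarrow> (\<exists>L. L-lipschitz_on {a..b} x) \<and> (\<forall>t\<in>{a..b}. norm (x t) \<le> r) \<and>
     negligible {t \<in> {a..b}. \<not> descends_at E {a..b} x t}"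

lemma confined_solution_subinterval:
  assumes sol: "confined_solution E r a b x" and "a \<le> s" "t \<le> b"
  shows "confined_solution E r s t x"
proof -
  have sub: "{s..t} \<subseteq> {a..b}"
    using assms by auto
  have "descends_at E {s..t} x \<tau>" if "descends_at E {a..b} x \<tau>" for \<tau>
    using that has_vector_derivative_within_subset[OF _ sub] unfolding descends_at_def by blast
  then have "{\<tau> \<in> {s..t}. \<not> descends_at E {s..t} x \<tau>} \<subseteq> {\<tau> \<in> {a..b}. \<not> descends_at E {a..b} x \<tau>}"
    using sub by blast
  then have "negligible {\<tau> \<in> {s..t}. \<not> descends_at E {s..t} x \<tau>}"
    using sol unfolding confined_solution_def by (blast intro: negligible_subset)
  moreover have "\<exists>L. L-lipschitz_on {s..t} x"
    using sol sub unfolding confined_solution_def by (blast intro: lipschitz_on_subset)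
  moreover have "\<forall>\<tau>\<in>{s..t}. norm (x \<tau>) \<le> r"
    using sol sub unfolding confined_solution_def by blast
  ultimately show ?thesis
    unfolding confined_solution_def by blast
qed

lemma confined_solutionI:
  fixes x :: "real \<Rightarrow> real^3^'n::finite"
  assumes sol: "filippov_solution (closed_loop E) T x" and r: "r < pi"
    and bnd: "\<And>t. t \<in> {0..T} \<Longrightarrow> norm (x t) \<le> r"
    and M: "0 \<le> M" "\<forall>x \<omega>. norm x \<le> r \<longrightarrow> descent E x \<omega> \<longrightarrow>
       norm (\<chi> i. transition_matrix (x $ i) *v \<omega> $ i) \<le> M"
  shows "confined_solution E r 0 T x" "M-lipschitz_on {0..T} x"
proof -
  let ?N = "{t \<in> {0..T}. \<not> (\<exists>v\<in>filippov (closed_loop E) (x t). (x has_vector_derivative v) (at t within {0..T}))}"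
  have ac: "abs_continuous_on_interval 0 T x" and N: "negligible ?N"
    using sol unfolding filippov_solution_iff by auto
  have vel: "descends_at E {0..T} x t"
    if t: "t \<in> {0..T} - ?N" for t
  proof -
    obtain v where v: "v \<in> filippov (closed_loop E) (x t)" "(x has_vector_derivative v) (at t within {0..T})"
      using t by blast
    have "norm (x t) < pi"
      using bnd[of t] t r by simp
    then have "\<forall>i. norm (x t $ i) < pi"
      using Finite_Cartesian_Product.norm_nth_le[of "x t"] order_le_less_trans by blast
    from filippov_closed_loop_descent[OF this v(1)] v(2) show ?thesis
      unfolding descends_at_def by blast
  qed
  show lip: "M-lipschitz_on {0..T} x"
  proof (rule abs_continuous_imp_lipschitz[OF ac M(1) N])
    fix t assume t: "t \<in> {0..T} - ?N"
    then have "norm (x t) \<le> r"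
      by (intro bnd) blast
    with M(2) vel[OF t] show "\<exists>v. norm v \<le> M \<and> (x has_vector_derivative v) (at t within {0..T})"
      unfolding descends_at_def by blast
  qed
  show "confined_solution E r 0 T x"
    unfolding confined_solution_def
  proof (intro conjI)
    show "negligible {t \<in> {0..T}. \<not> descends_at E {0..T} x t}"
      by (rule negligible_subset[OF N]) (use vel in blast)
  qed (use lip bnd in auto)
qed

text \<open>The derivative of \<open>\<parallel>x\<parallel>\<^sup>2\<close> is \<open>2 * (x
  \<bullet> v) = 2 * (x \<bullet> \<omega>) = - 2 * disagreement E x\<close>, because the transition
  matrices leave the pairing with \<open>x\<close> unchanged.\<close>

lemma confined_solution_norm_decreasing:
  assumes sol: "confined_solution E r a b x" and ab: "a \<le> b"
  shows "norm (x b) \<le> norm (x a)"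
proof -
  obtain L where L: "L-lipschitz_on {a..b} x"
    using sol unfolding confined_solution_def by blast
  have bnd: "norm (x t) \<le> r" if "t \<in> {a..b}" for t
    using sol that unfolding confined_solution_def by blast
  let ?N = "{t \<in> {a..b}. \<not> descends_at E {a..b} x t}"
  have r: "0 \<le> r"
    using order_trans[OF norm_ge_zero bnd[of a]] ab by simp
  have "(2 * r * L)-lipschitz_on {a..b} (\<lambda>t. x t \<bullet> x t)"
  proof (rule lipschitz_onI)
    fix s t assume st: "s \<in> {a..b}" "t \<in> {a..b}"
    have "x s \<bullet> x s - x t \<bullet> x t = (x s + x t) \<bullet> (x s - x t)"
      by (simp add: inner_add_left inner_diff_right inner_commute[of "x t" "x s"])
    then have "\<bar>x s \<bullet> x s - x t \<bullet> x t\<bar> \<le> norm (x s + x t) * norm (x s - x t)"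
      by (simp add: Cauchy_Schwarz_ineq2)
    also have "\<dots> \<le> (2 * r) * (L * norm (s - t))"
      using bnd[OF st(1)] bnd[OF st(2)] norm_triangle_ineq[of "x s" "x t"] r
      by (intro mult_mono lipschitz_on_normD[OF L st]) auto
    finally show "dist (x s \<bullet> x s) (x t \<bullet> x t) \<le> 2 * r * L * dist s t"
      by (simp add: dist_norm mult_ac)
  qed (use r lipschitz_on_nonneg[OF L] in simp)
  then have ac: "abs_continuous_on_interval a b (\<lambda>t. x t \<bullet> x t)"
    by (rule lipschitz_imp_abs_continuous)
  have N: "negligible ?N"
    using sol unfolding confined_solution_def by blast
  have "x b \<bullet> x b - x a \<bullet> x a \<le> 0 * (b - a)"
  proof (rule abs_continuous_upper_bound[OF ac ab N])
    fix t assume t: "t \<in> {a..b} - ?N"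
    then obtain \<omega> where \<omega>: "descent E (x t) \<omega>"
      "(x has_vector_derivative (\<chi> i. transition_matrix (x t $ i) *v \<omega> $ i)) (at t within {a..b})"
      unfolding descends_at_def by blast
    let ?v = "\<chi> i. transition_matrix (x t $ i) *v \<omega> $ i"
    have "((\<lambda>t. x t \<bullet> x t) has_real_derivative (x t \<bullet> ?v + ?v \<bullet> x t)) (at t within {a..b})"
      unfolding has_real_derivative_iff_has_vector_derivative
      by (rule bounded_bilinear.has_vector_derivative[OF bounded_bilinear_inner \<omega>(2) \<omega>(2)])
    moreover have "x t \<bullet> ?v = \<omega> \<bullet> x t"
      by (simp add: inner_vec_def[of "x t"] inner_vec_def[of \<omega>] inner_transition_matrix)
        (simp add: inner_commute)
    then have "x t \<bullet> ?v + ?v \<bullet> x t \<le> 0"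
      using descent_inner_self[OF \<omega>(1)] disagreement_nonneg[of E "x t"] by (simp add: inner_commute)
    ultimately show "\<exists>d\<le>0. ((\<lambda>t. x t \<bullet> x t) has_real_derivative d) (at t within {a..b})"
      by blast
  qed
  then show ?thesis
    by (simp add: norm_le)
qed

text \<open>The decay of the norm is only known inside the ball of radius \<open>pi\<close>. A
  solution that exceeded its initial norm would reach, at a first time, some radius \<open>r\<close>
  strictly between that norm and \<open>pi\<close>; up to this time it is confined, which
  contradicts the decay.\<close>

lemma filippov_solution_norm_le:
  fixes x :: "real \<Rightarrow> real^3^'n::finite"
  assumes sol: "filippov_solution (closed_loop E) T x" and "norm (x 0) < pi" and "0 \<le> T"
  shows "norm (x T) \<le> norm (x 0)"
proof (rule ccontr)
  assume "\<not> norm (x T) \<le> norm (x 0)"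
  then obtain r where r: "norm (x 0) < r" "r < pi" "r < norm (x T)"
    using dense[of "norm (x 0)" "min pi (norm (x T))"] assms(2) by auto
  have cont: "continuous_on {0..T} (\<lambda>t. norm (x t))"
    using sol unfolding filippov_solution_iff
    by (intro continuous_on_norm abs_continuous_imp_continuous) blast
  define A where "A = {t \<in> {0..T}. norm (x t) = r}"
  have "closed A"
    using continuous_closed_preimage[OF cont closed_real_atLeastAtMost closed_singleton[of r]]
    by (simp add: A_def vimage_def Int_def)
  moreover have "A \<noteq> {}"
    using IVT'[of "\<lambda>t. norm (x t)" 0 r T] r cont \<open>0 \<le> T\<close> by (auto simp: A_def)
  moreover have bdd: "bdd_below A"
    by (rule bdd_belowI[of _ 0]) (auto simp: A_def)
  ultimately have "Inf A \<in> A"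
    by (intro closed_contains_Inf)
  define s where "s = Inf A"
  have "s \<in> A"
    unfolding s_def by fact
  then have s: "0 \<le> s" "s \<le> T" "norm (x s) = r"
    by (simp_all add: A_def)
  have bnd: "norm (x t) \<le> r" if t: "t \<in> {0..s}" for t
  proof (rule ccontr)
    assume "\<not> norm (x t) \<le> r"
    moreover have "continuous_on {0..t} (\<lambda>t. norm (x t))"
      using cont by (rule continuous_on_subset) (use t s in auto)
    ultimately obtain u where u: "0 \<le> u" "u \<le> t" "norm (x u) = r"
      using IVT'[of "\<lambda>t. norm (x t)" 0 r t] r t by auto
    then have "u \<in> A"
      using t s by (auto simp: A_def)
    then have "s \<le> u"
      unfolding s_def using bdd by (rule cInf_lower)
    then have "u = t"
      using u t by auto
    with u \<open>\<not> norm (x t) \<le> r\<close> show False by simp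
  qed
  have "filippov_solution (closed_loop E) s x"
    using filippov_solution_subinterval[OF sol s(2)] .
  moreover obtain M where M: "0 \<le> M" "\<forall>x \<omega>. norm x \<le> r \<longrightarrow> descent E x \<omega> \<longrightarrow>
       norm (\<chi> i. transition_matrix (x $ i) *v \<omega> $ i) \<le> M"
    using closed_loop_velocity_bound[OF r(2), of E] by blast
  ultimately have "confined_solution E r 0 s x"
    using r(2) bnd M by (intro confined_solutionI(1)[where M = M])
  from confined_solution_norm_decreasing[OF this s(1)] show False
    using r(1) s(3) by simp
qed

text \<open>The subgradient inequality says that \<open>disagreement E (x s) + \<omega> \<bullet> x
  s\<close> is minimal at \<open>s = t\<close>, so its derivative vanishes there.\<close>

lemma disagreement_derivative:
  assumes desc: "descent E (x t) \<omega>" and t: "t \<in> {a<..<b}"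
    and x: "(x has_vector_derivative v) (at t within {a..b})"
    and V: "((\<lambda>t. disagreement E (x t)) has_real_derivative d) (at t within {a..b})"
  shows "d = - (\<omega> \<bullet> v)"
proof -
  have at: "at t within {a..b} = at t"
    using t by (intro at_within_interior) simp
  have "((\<lambda>s. \<omega> \<bullet> x s) has_real_derivative \<omega> \<bullet> v) (at t)"
    unfolding has_real_derivative_iff_has_vector_derivative
    using bounded_linear.has_vector_derivative[OF bounded_linear_inner_right x[unfolded at]] .
  with V[unfolded at] have "((\<lambda>s. disagreement E (x s) + \<omega> \<bullet> x s) has_real_derivative d + \<omega> \<bullet> v) (at t)"
    by (rule DERIV_add)
  moreover have "disagreement E (x t) + \<omega> \<bullet> x t \<le> disagreement E (x s) + \<omega> \<bullet> x s" for s
    using desc[unfolded descent_def, rule_format, of "x s"] by (simp add: inner_diff_right)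
  ultimately have "d + \<omega> \<bullet> v = 0"
    by (intro DERIV_local_min[of _ _ t 1]) auto
  then show ?thesis by simp
qed

text \<open>The derivative of the disagreement is \<open>- (\<omega> \<bullet> v)\<close> almost
  everywhere, and coercivity in each block bounds \<open>\<omega> \<bullet> v\<close> below by
  \<open>\<gamma> * (norm \<omega>)\<^sup>2\<close>. The choice \<open>\<kappa> = 0\<close> gives
  plain monotonicity.\<close>

lemma confined_solution_disagreement_rate:
  fixes x :: "real \<Rightarrow> real^3^'n::finite"
  assumes sol: "confined_solution E r a b x" and ab: "a \<le> b"
    and coercive: "\<And>y w. norm y \<le> r \<Longrightarrow> \<gamma> * (norm w)\<^sup>2 \<le> w \<bullet> (transition_matrix y *v w)" and "0 \<le> \<gamma>"
    and \<kappa>: "0 \<le> \<kappa>" "\<And>t \<omega>. \<lbrakk>t \<in> {a..b}; descent E (x t) \<omega>\<rbrakk> \<Longrightarrow> \<kappa> \<le> norm \<omega>"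
  shows "disagreement E (x b) - disagreement E (x a) \<le> - (\<gamma> * \<kappa>\<^sup>2) * (b - a)"
proof -
  obtain L where L: "L-lipschitz_on {a..b} x"
    using sol unfolding confined_solution_def by blast
  obtain C where C: "C-lipschitz_on UNIV (disagreement E)"
    using disagreement_lipschitz by metis
  have lip: "(C * L)-lipschitz_on {a..b} (\<lambda>t. disagreement E (x t))"
    by (rule lipschitz_on_compose2[OF L lipschitz_on_subset[OF C subset_UNIV]])
  define N1 where "N1 = {t \<in> {a..b}. \<not> descends_at E {a..b} x t}"
  define N2 where "N2 = {t \<in> {a..b}. \<nexists>d. ((\<lambda>t. disagreement E (x t)) has_real_derivative d) (at t within {a..b})}"
  have N1: "negligible N1"
    using sol unfolding confined_solution_def N1_def by blast
  have N2: "negligible N2"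
    unfolding N2_def by (rule lipschitz_real_differentiable_ae[OF lip])
  have "negligible (N1 \<union> N2 \<union> {a, b})"
    using negligible_Un[OF negligible_Un[OF N1 N2], of "{a, b}"] negligible_finite by simp
  then show ?thesis
  proof (rule abs_continuous_upper_bound[OF lipschitz_imp_abs_continuous[OF lip] ab])
    \<comment> \<open>the endpoints are excluded because the minimum argument needs two-sided
      derivatives\<close>
    fix t assume t: "t \<in> {a..b} - (N1 \<union> N2 \<union> {a, b})"
    then have t': "t \<in> {a<..<b}" by auto
    obtain \<omega> where \<omega>: "descent E (x t) \<omega>"
      "(x has_vector_derivative (\<chi> i. transition_matrix (x t $ i) *v \<omega> $ i)) (at t within {a..b})"
      using t unfolding N1_def descends_at_def by blast
    obtain d where d: "((\<lambda>t. disagreement E (x t)) has_real_derivative d) (at t within {a..b})"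
      using t unfolding N2_def by blast
    have "norm (x t) \<le> r"
      using sol t' unfolding confined_solution_def by auto
    then have comp: "norm (x t $ i) \<le> r" for i
      using Finite_Cartesian_Product.norm_nth_le[of "x t" i] by simp
    have "\<gamma> * \<kappa>\<^sup>2 \<le> \<gamma> * (norm \<omega>)\<^sup>2"
      using \<kappa>(1) \<kappa>(2)[OF _ \<omega>(1)] t' \<open>0 \<le> \<gamma>\<close> by (intro mult_left_mono power_mono) auto
    also have "\<dots> = (\<Sum>i\<in>UNIV. \<gamma> * (norm (\<omega> $ i))\<^sup>2)"
      by (simp add: power2_norm_eq_inner inner_vec_def[of \<omega>] sum_distrib_left)
    also have "\<dots> \<le> (\<Sum>i\<in>UNIV. \<omega> $ i \<bullet> (transition_matrix (x t $ i) *v \<omega> $ i))"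
      by (intro sum_mono coercive comp)
    also have "\<dots> = \<omega> \<bullet> (\<chi> i. transition_matrix (x t $ i) *v \<omega> $ i)"
      by (simp add: inner_vec_def[of \<omega>])
    finally have "d \<le> - (\<gamma> * \<kappa>\<^sup>2)"
      using disagreement_derivative[OF \<omega>(1) t' \<omega>(2) d] by simp
    with d show "\<exists>d\<le>- (\<gamma> * \<kappa>\<^sup>2). ((\<lambda>t. disagreement E (x t)) has_real_derivative d) (at t within {a..b})"
      by blast
  qed
qed

lemma disagreement_zero_imp_diagonal:
  assumes "connected_graph E" "disagreement E x = 0"
  shows "x = (\<chi> i. x $ j)"
proof -
  obtain K where "\<And>x i j. norm (x $ j - x $ i) \<le> K * disagreement E x"
    using connected_disagreement_bound[OF assms(1)] by metis
  from this[of x _ j] assms(2) have "x $ i = x $ j" for i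
    by simp
  then show ?thesis
    by (simp add: vec_eq_iff[of x])
qed

text \<open>When all blocks agree, they share the transition matrix \<open>L\<close>, so the
  derivative of their sum is \<open>L\<close> applied to the sum of the descent components, which is
  \<open>0\<close>. The sum determines the common value.\<close>

lemma confined_solution_constant_after_consensus:
  fixes x :: "real \<Rightarrow> real^3^'n::finite"
  assumes sol: "confined_solution E r a b x" and ab: "a \<le> b" and conn: "connected_graph E"
    and zero: "\<And>t. t \<in> {a..b} \<Longrightarrow> disagreement E (x t) = 0"
  shows "x b = x a"
proof -
  define S where "S t = (\<Sum>i\<in>UNIV. x t $ i)" for t
  have diag: "x t = (\<chi> i. x t $ j)" if "t \<in> {a..b}" for t j
    using disagreement_zero_imp_diagonal[OF conn zero[OF that]] .
  have S_diag: "S t = real CARD('n) *\<^sub>R x t $ j" if "t \<in> {a..b}" for t j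
  proof -
    have "S t = (\<Sum>i\<in>(UNIV :: 'n set). x t $ j)"
      unfolding S_def by (subst diag[OF that, of j]) simp
    then show ?thesis
      by (simp add: scaleR_conv_of_real sum_constant_scaleR)
  qed
  obtain L where L: "L-lipschitz_on {a..b} x"
    using sol unfolding confined_solution_def by blast
  have blin: "bounded_linear (\<lambda>y :: real^3^'n. \<Sum>i\<in>UNIV. y $ i)"
    by (intro bounded_linear_sum bounded_linear_vec_nth)
  then obtain B where B: "B-lipschitz_on UNIV (\<lambda>y :: real^3^'n. \<Sum>i\<in>UNIV. y $ i)"
    by (rule bounded_linear.lipschitz_boundE) 
  have "(B * L)-lipschitz_on {a..b} S"
    unfolding S_def by (rule lipschitz_on_compose2[OF L lipschitz_on_subset[OF B subset_UNIV]])
  then have ac: "abs_continuous_on_interval a b S"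
    by (rule lipschitz_imp_abs_continuous)
  have "0-lipschitz_on {a..b} S"
  proof (rule abs_continuous_imp_lipschitz[OF ac order_refl])
    show "negligible {t \<in> {a..b}. \<not> descends_at E {a..b} x t}"
      using sol unfolding confined_solution_def by blast
    fix t assume t: "t \<in> {a..b} - {t \<in> {a..b}. \<not> descends_at E {a..b} x t}"
    then have t': "t \<in> {a..b}" by blast
    obtain \<omega> where \<omega>: "descent E (x t) \<omega>"
      "(x has_vector_derivative (\<chi> i. transition_matrix (x t $ i) *v \<omega> $ i)) (at t within {a..b})"
      using t unfolding descends_at_def by blast
    define m where "m = x t $ undefined"
    have "x t $ i = m" for i
      using arg_cong[OF diag[OF t', of undefined], of "\<lambda>y. y $ i"] by (simp add: m_def)
    then have "(\<Sum>i\<in>UNIV. (\<chi> i. transition_matrix (x t $ i) *v \<omega> $ i) $ i) = transition_matrix m *v (\<Sum>i\<in>UNIV. \<omega> $ i)"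
      by (simp add: vec.sum)
    also have "\<dots> = 0"
      by (simp add: descent_sum_zero[OF \<omega>(1)])
    finally have "(S has_vector_derivative 0) (at t within {a..b})"
      unfolding S_def using bounded_linear.has_vector_derivative[OF blin \<omega>(2)] by simp
    then show "\<exists>v. norm v \<le> 0 \<and> (S has_vector_derivative v) (at t within {a..b})"
      by auto
  qed
  then have "S b = S a"
    using lipschitz_onD[of 0 "{a..b}" S b a] ab by simp
  then have "x b $ j = x a $ j" for j
    using S_diag[of a j] S_diag[of b j] ab by simp
  then show ?thesis
    by (simp add: vec_eq_iff)
qed

lemma negligible_coordinate_tie:
  fixes i j :: "'n::finite" and k :: "'m::finite"
  assumes "i \<noteq> j"
  shows "negligible {z :: real^'m^'n. z $ j $ k = z $ i $ k}"
proof -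
  let ?a = "axis j (axis k 1) - axis i (axis k 1) :: real^'m^'n"
  have "?a $ j $ k = 1"
    using assms by (simp add: axis_def)
  then have "?a \<noteq> 0"
    by (metis zero_index zero_neq_one)
  then have "negligible {z. ?a \<bullet> z = 0}"
    by (intro negligible_hyperplane) simp
  moreover have "?a \<bullet> z = z $ j $ k - z $ i $ k" for z
    by (simp add: inner_diff_left inner_axis' )
  ultimately show ?thesis
    by simp
qed

lemma isCont_closed_loop:
  fixes z :: "real^3^'n::finite"
  assumes small: "norm z < 2 * pi" and no_tie: "\<And>i j k. j \<in> neighbours E i \<Longrightarrow> z $ j $ k \<noteq> z $ i $ k"
  shows "isCont (closed_loop E) z"
proof -
  have lim: "((\<lambda>z. transition_matrix (z $ i) *v controller E z i) \<longlongrightarrow>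
      transition_matrix (z $ i) *v controller E z i) (at z)" for i
  proof (rule tendsto_matrix_vector_mult)
    have "norm (z $ i) < 2 * pi"
      using Finite_Cartesian_Product.norm_nth_le[of z i] small by simp
    then show "((\<lambda>z. transition_matrix (z $ i)) \<longlongrightarrow> transition_matrix (z $ i)) (at z)"
      by (intro isCont_tendsto_compose[OF isCont_transition_matrix] tendsto_vec_nth tendsto_ident_at)
    show "((\<lambda>z. controller E z i) \<longlongrightarrow> controller E z i) (at z)"
      unfolding controller_def vsign_def using no_tie
      by (intro tendsto_sum vec_tendstoI) (auto intro!: tendsto_intros tendsto_sgn)
  qed
  show ?thesis
    unfolding isCont_def closed_loop_def by (rule vec_tendstoI) (simp add: lim)
qed

text \<open>The closed loop is continuous unless two neighbours agree in some coordinate, and these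
  ties form finitely many hyperplanes.\<close>

lemma closed_loop_local_solution:
  fixes E :: "'n::finite set set"
  assumes graph: "undirected_graph E" and x0: "norm x0 < pi"
  obtains \<tau> y L where "0 < \<tau>" "y 0 = x0" "L-lipschitz_on {0..\<tau>} y"
    "negligible {t \<in> {0..\<tau>}. \<not> (\<exists>v\<in>filippov (closed_loop E) (y t). (y has_vector_derivative v) (at t within {0..\<tau>}))}"
proof -
  define \<rho> where "\<rho> = (pi - norm x0) / 2"
  have \<rho>: "0 < \<rho>" "norm x0 + \<rho> < pi"
    using x0 by (auto simp: \<rho>_def field_simps)
  define tie where "tie = (\<lambda>(i, j, k). {z :: real^3^'n. z $ j $ k = z $ i $ k})"
  define T where "T = (\<Union>p\<in>{(i, j, k). j \<in> neighbours E i}. tie p)"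
  have loop_free: "i \<noteq> j" if "j \<in> neighbours E i" for i j
    using graph that by (auto simp: undirected_graph_def neighbours_def)
  have T: "negligible T"
    unfolding T_def
  proof (rule negligible_Union)
    fix S assume "S \<in> tie ` {(i, j, k). j \<in> neighbours E i}"
    then obtain i j k where "j \<in> neighbours E i" "S = {z. z $ j $ k = z $ i $ k}"
      by (auto simp: tie_def)
    then show "negligible S"
      using negligible_coordinate_tie[OF loop_free] by simp
  qed simp
  have near: "norm z < norm x0 + \<rho>" if "z \<in> ball x0 \<rho>" for z
    using that norm_triangle_sub[of z x0] by (simp add: dist_norm norm_minus_commute)
  obtain M where M: "0 \<le> M" "\<forall>x \<omega>. norm x \<le> norm x0 + \<rho> \<longrightarrow> descent E x \<omega> \<longrightarrow>
       norm (\<chi> i. transition_matrix (x $ i) *v \<omega> $ i) \<le> M"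
    using closed_loop_velocity_bound[OF \<rho>(2), of E] by blast
  have bnd: "\<forall>z\<in>ball x0 \<rho>. norm (closed_loop E z) \<le> M"
  proof
    fix z assume "z \<in> ball x0 \<rho>"
    then show "norm (closed_loop E z) \<le> M"
      using M(2)[rule_format, OF _ descent_controller, of z] near[of z] by (simp add: closed_loop_def)
  qed
  have cont: "\<forall>z\<in>ball x0 \<rho> - T. isCont (closed_loop E) z"
  proof
    fix z assume z: "z \<in> ball x0 \<rho> - T"
    show "isCont (closed_loop E) z"
    proof (rule isCont_closed_loop)
      show "norm z < 2 * pi"
      proof -
        have "norm z < norm x0 + \<rho>"
          using z by (intro near) blast
        then show ?thesis
          using \<rho>(2) pi_gt_zero by linarith
      qed
      show "z $ j $ k \<noteq> z $ i $ k" if "j \<in> neighbours E i" for i j k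
        using z that by (auto simp: T_def tie_def)
    qed
  qed
  show thesis
    by (rule filippov_local_existence[OF \<rho>(1) T M(1) bnd cont]) (rule that)
qed

section \<open>Maximal solutions and finite-time synchronization\<close>

text \<open>A solution on a bounded domain is Lipschitz, hence extends to the supremum
  \<open>T\<close> of the domain regardless of whether \<open>T\<close> belongs to it. Gluing on a
  local solution from time \<open>T\<close> contradicts maximality in either case.\<close>

lemma maximal_solution_domain:
  fixes x :: "real \<Rightarrow> real^3^'n::finite"
  assumes graph: "undirected_graph E" and sol: "maximal_filippov_solution (closed_loop E) D x"
    and x0: "norm (x 0) < pi"
  shows "D = {0..}"
proof (rule ccontr)
  assume "D \<noteq> {0..}"
  let ?X = "closed_loop E"
  have on: "filippov_solution_on ?X D x"
    and maximal: "\<And>D' y. D \<subset> D' \<Longrightarrow> filippov_solution_on ?X D' y \<Longrightarrow> (\<forall>t\<in>D. y t = x t) \<Longrightarrow> False"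
    using sol unfolding maximal_filippov_solution_def by blast+
  have D: "is_interval D" "0 \<in> D" "D \<subseteq> {0..}" "D \<noteq> {0}"
    and sol_T: "\<And>T. T \<in> D \<Longrightarrow> 0 < T \<Longrightarrow> filippov_solution ?X T x"
    using on unfolding filippov_solution_on_def by blast+
  have down: "s \<in> D" if "t \<in> D" "0 \<le> s" "s \<le> t" for s t
    using D(1,2) that unfolding is_interval_1 by blast
  obtain b where b: "0 \<le> b" "b \<notin> D"
    using \<open>D \<noteq> {0..}\<close> D(3) by auto
  have lt_b: "t < b" if "t \<in> D" for t
    using down[OF that b(1)] b(2) by (meson not_le)
  have bdd: "bdd_above D"
    using lt_b by (auto intro!: bdd_aboveI[of _ b] less_imp_le)
  define T where "T = Sup D"
  have le_T: "t \<le> T" if "t \<in> D" for t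
    unfolding T_def using that bdd by (rule cSup_upper)
  have below_T: "s \<in> D" if s: "0 \<le> s" "s < T" for s
  proof -
    obtain t where "t \<in> D" "s < t"
      using less_cSupE[of s D] s(2) D(2) unfolding T_def by blast
    then show ?thesis
      using down s(1) by auto
  qed
  have "0 < T"
  proof -
    obtain t where "t \<in> D" "t \<noteq> 0"
      using D(2,4) by blast
    then show ?thesis
      using D(3) le_T[of t] by fastforce
  qed
  have bnd: "norm (x t) \<le> norm (x 0)" if t: "t \<in> D" for t
  proof (cases "t = 0")
    case False
    then have "0 < t"
      using D(3) t by fastforce
    then show ?thesis
      using filippov_solution_norm_le[OF sol_T[OF t] x0] by simp
  qed simp
  obtain M where M: "0 \<le> M" "\<forall>z \<omega>. norm z \<le> norm (x 0) \<longrightarrow> descent E z \<omega> \<longrightarrow>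
       norm (\<chi> i. transition_matrix (z $ i) *v \<omega> $ i) \<le> M"
    using closed_loop_velocity_bound[OF x0, of E] by blast
  have lip_D: "M-lipschitz_on D x"
  proof (rule lipschitz_on_leI[OF _ M(1)])
    fix s t assume st: "s \<in> D" "t \<in> D" "s \<le> t"
    show "dist (x s) (x t) \<le> M * dist s t"
    proof (cases "t = 0")
      case True
      then have "s = 0"
        using st D(3) by fastforce
      with True show ?thesis by simp
    next
      case False
      then have "0 < t" "0 \<le> s"
        using D(3) st(1,2) by fastforce+
      have "norm (x \<tau>) \<le> norm (x 0)" if "\<tau> \<in> {0..t}" for \<tau>
        using down[OF st(2), of \<tau>] that by (intro bnd) auto
      then have "M-lipschitz_on {0..t} x"
        using M by (intro confined_solutionI(2)[OF sol_T[OF st(2) \<open>0 < t\<close>] x0])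
      then show ?thesis
        by (rule lipschitz_onD) (use \<open>0 \<le> s\<close> st(3) in auto)
    qed
  qed
  obtain g where g: "M-lipschitz_on (closure D) g" "\<And>t. t \<in> D \<Longrightarrow> g t = x t"
    using lipschitz_extend_closure[OF lip_D] by blast
  have "T \<in> closure D"
    unfolding T_def using D(2) bdd by (intro closure_contains_Sup) auto
  then have "{0..T} \<subseteq> closure D"
    using below_T closure_subset[of D] by (force simp: less_le)
  with g(1) have lip_g: "M-lipschitz_on {0..T} g"
    by (rule lipschitz_on_subset)
  \<comment> \<open>times in \<open>D\<close> increasing to \<open>T\<close>; the exceptional sets
    for \<open>{0..c n}\<close> together cover the one for \<open>{0..<T}\<close>\<close>
  define c where "c n = T - T / real (n + 2)" for n
  have c: "0 < c n" "c n < T" for n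
    using \<open>0 < T\<close> by (auto simp: c_def field_simps intro: add_pos_nonneg)
  then have cD: "c n \<in> D" for n
    by (intro below_T) (auto intro: less_imp_le)
  have neg_g: "negligible {t \<in> {0..T}. \<not> filippov_at ?X {0..T} g t}"
  proof (rule negligible_subset)
    have "negligible {t \<in> {0..c n}. \<not> filippov_at ?X {0..c n} x t}" for n
      using sol_T[OF cD c(1)] unfolding filippov_solution_iff filippov_at_def by blast
    then have "negligible (\<Union>n. {t \<in> {0..c n}. \<not> filippov_at ?X {0..c n} x t})"
      by (intro negligible_countable_Union) auto
    then show "negligible ((\<Union>n. {t \<in> {0..c n}. \<not> filippov_at ?X {0..c n} x t}) \<union> {T})"
      by (intro negligible_Un negligible_sing)
    show "{t \<in> {0..T}. \<not> filippov_at ?X {0..T} g t} \<subseteq> (\<Union>n. {t \<in> {0..c n}. \<not> filippov_at ?X {0..c n} x t}) \<union> {T}"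
    proof
      fix t assume t: "t \<in> {t \<in> {0..T}. \<not> filippov_at ?X {0..T} g t}"
      show "t \<in> (\<Union>n. {t \<in> {0..c n}. \<not> filippov_at ?X {0..c n} x t}) \<union> {T}"
      proof (cases "t = T")
        case False
        with t have "0 \<le> t" "t < T" by auto
        then obtain n :: nat where "T / (T - t) < real n"
          using reals_Archimedean2 by blast
        then have "T < real (n + 2) * (T - t)"
          using \<open>t < T\<close> by (simp add: pos_divide_less_eq distrib_right)
        then have "t < c n"
          by (simp add: c_def pos_divide_less_eq field_simps)
        have "filippov_at ?X {0..T} g t" if "filippov_at ?X {0..c n} x t"
        proof (rule filippov_at_local_transfer[OF that, of "{..<c n}"])
          show "{0..c n} \<inter> {..<c n} = {0..T} \<inter> {..<c n}"
            using c(2)[of n] by auto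
          show "x s = g s" if "s \<in> {0..c n} \<inter> {..<c n}" for s
            using down[OF cD, of s n] that g(2)[of s] by auto
        qed (use \<open>0 \<le> t\<close> \<open>t < c n\<close> in auto)
        then show ?thesis
          using t \<open>t < c n\<close> by auto
      qed simp
    qed
  qed
  have sol_g: "filippov_solution ?X T g"
    by (rule lipschitz_filippov_solution[OF lip_g neg_g])
  have "norm (g T) < pi"
    using filippov_solution_norm_le[OF sol_g] g(2)[OF D(2)] x0 \<open>0 < T\<close> by simp
  then obtain \<tau> y L where \<tau>: "0 < \<tau>" and y0: "y 0 = g T" and lip_y: "L-lipschitz_on {0..\<tau>} y"
    and neg_y: "negligible {t \<in> {0..\<tau>}. \<not> (\<exists>v\<in>filippov ?X (y t). (y has_vector_derivative v) (at t within {0..\<tau>}))}"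
    by (rule closed_loop_local_solution[OF graph])
  define z where "z t = (if t \<le> T then g t else y (t - T))" for t
  have "L-lipschitz_on {T..T + \<tau>} (\<lambda>t. y (t - T))"
  proof (rule lipschitz_onI)
    fix s t assume "s \<in> {T..T + \<tau>}" "t \<in> {T..T + \<tau>}"
    then have "dist (y (s - T)) (y (t - T)) \<le> L * dist (s - T) (t - T)"
      by (intro lipschitz_onD[OF lip_y]) auto
    then show "dist (y (s - T)) (y (t - T)) \<le> L * dist s t"
      by (simp add: dist_real_def)
  qed (rule lipschitz_on_nonneg[OF lip_y])
  from lipschitz_on_concat_max[OF lip_g this]
  have lip_z: "(max M L)-lipschitz_on {0..T + \<tau>} z"
    by (simp add: y0 z_def[abs_def])
  have neg_z: "negligible {t \<in> {0..T + \<tau>}. \<not> filippov_at ?X {0..T + \<tau>} z t}"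
  proof (rule negligible_subset)
    let ?Ny = "{t \<in> {0..\<tau>}. \<not> filippov_at ?X {0..\<tau>} y t}"
    have "negligible ?Ny"
      using neg_y unfolding filippov_at_def .
    then show "negligible ({t \<in> {0..T}. \<not> filippov_at ?X {0..T} g t} \<union> {T} \<union> (+) T ` ?Ny)"
      by (intro negligible_Un negligible_sing negligible_translation neg_g)
    show "{t \<in> {0..T + \<tau>}. \<not> filippov_at ?X {0..T + \<tau>} z t} \<subseteq>
        {t \<in> {0..T}. \<not> filippov_at ?X {0..T} g t} \<union> {T} \<union> (+) T ` ?Ny"
    proof
      fix t assume t: "t \<in> {t \<in> {0..T + \<tau>}. \<not> filippov_at ?X {0..T + \<tau>} z t}"
      consider "t < T" | "t = T" | "T < t" by linarith
      then show "t \<in> {t \<in> {0..T}. \<not> filippov_at ?X {0..T} g t} \<union> {T} \<union> (+) T ` ?Ny"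
      proof cases
        case 1
        have "filippov_at ?X {0..T + \<tau>} z t" if "filippov_at ?X {0..T} g t"
          by (rule filippov_at_local_transfer[OF that, of "{..<T}"]) (use 1 t \<tau> in \<open>auto simp: z_def\<close>)
        then show ?thesis
          using t 1 by auto
      next
        case 3
        have "filippov_at ?X {0..T + \<tau>} z t" if good: "filippov_at ?X {0..\<tau>} y (t - T)"
        proof -
          obtain v where v: "v \<in> filippov ?X (y (t - T))" "(y has_vector_derivative v) (at (t - T) within {0..\<tau>})"
            using good unfolding filippov_at_def by blast
          have "(\<lambda>t. t - T) ` {T..T + \<tau>} = {0..\<tau>}"
            by simp
          with v(2) have "(y has_vector_derivative v) (at (t - T) within (\<lambda>t. t - T) ` {T..T + \<tau>})"
            by simp
          moreover have "((\<lambda>t. t - T) has_vector_derivative 1) (at t within {T..T + \<tau>})"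
            by (auto intro!: derivative_eq_intros)
          ultimately have "(y \<circ> (\<lambda>t. t - T) has_vector_derivative 1 *\<^sub>R v) (at t within {T..T + \<tau>})"
            by (intro vector_diff_chain_within)
          then have "filippov_at ?X {T..T + \<tau>} (\<lambda>t. y (t - T)) t"
            using v(1) unfolding filippov_at_def by (auto simp: o_def)
          then show ?thesis
            by (rule filippov_at_local_transfer[of _ _ _ _ "{T<..}"])
              (use 3 t \<tau> \<open>0 < T\<close> in \<open>auto simp: z_def\<close>)
        qed
        then have "t - T \<in> ?Ny"
          using t 3 by auto
        then have "t \<in> (+) T ` ?Ny"
          by (intro image_eqI[of _ _ "t - T"]) simp_all
        then show ?thesis by blast
      qed simp
    qed
  qed
  have "filippov_solution ?X (T + \<tau>) z"
    by (rule lipschitz_filippov_solution[OF lip_z neg_z])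
  then have "filippov_solution_on ?X {0..T + \<tau>} z"
    unfolding filippov_solution_on_def using \<open>0 < T\<close> \<tau>
    by (auto intro: filippov_solution_subinterval simp: is_interval_cc)
  moreover have "D \<subset> {0..T + \<tau>}"
  proof
    show "D \<subseteq> {0..T + \<tau>}"
      using D(3) le_T \<tau> by fastforce
    have "T + \<tau> \<notin> D"
      using le_T[of "T + \<tau>"] \<tau> by auto
    then show "D \<noteq> {0..T + \<tau>}"
      using \<open>0 < T\<close> \<tau> by auto
  qed
  moreover have "\<forall>t\<in>D. z t = x t"
    using le_T g(2) by (simp add: z_def)
  ultimately show False
    using maximal by blast
qed

lemma norm_hat: "norm (hat p) = sqrt 2 * norm p"
proof -
  have "(norm (hat p))\<^sup>2 = 2 * (norm p)\<^sup>2"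
    by (simp add: power2_norm_eq_inner inner_vec_def sum_3 hat_def)
  then show ?thesis
    by (metis norm_ge_zero real_sqrt_abs2 real_sqrt_mult real_sqrt_power abs_of_nonneg power2_eq_square)
qed

text \<open>No initial rotation has angle \<open>pi\<close>, since a single one would already
  contribute \<open>pi\<^sup>2\<close> to the sum. The sum is therefore the squared norm of the
  stacked initial state.\<close>

lemma initial_norm_less_pi:
  fixes R :: "'n::finite \<Rightarrow> real^3^3" and x0 :: "real^3^'n"
  assumes near: "(\<Sum>i\<in>UNIV. (so3_dist (mat 1) (R i))\<^sup>2) < pi\<^sup>2"
    and init: "\<And>i. hat (x0 $ i) = so3_log (R i)"
  shows "norm x0 < pi"
proof -
  have "matrix_inv (mat 1 :: real^3^3) = mat 1"
  proof -
    have "mat 1 ** matrix_inv (mat 1 :: real^3^3) = mat 1 \<and> matrix_inv (mat 1) ** (mat 1 :: real^3^3) = mat 1"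
      unfolding matrix_inv_def by (rule someI[of _ "mat 1"]) simp
    then show ?thesis by simp
  qed
  then have dist: "so3_dist (mat 1) (R i) = (if rot_angle (R i) = pi then pi else norm (x0 $ i))" for i
    by (simp add: so3_dist_def init[symmetric] norm_hat)
  have "rot_angle (R i) \<noteq> pi" for i
  proof
    assume "rot_angle (R i) = pi"
    then have "pi\<^sup>2 = (so3_dist (mat 1) (R i))\<^sup>2"
      by (simp add: dist)
    also have "\<dots> \<le> (\<Sum>i\<in>UNIV. (so3_dist (mat 1) (R i))\<^sup>2)"
      by (rule member_le_sum) auto
    finally show False
      using near by simp
  qed
  then have "(norm x0)\<^sup>2 < pi\<^sup>2"
    using near by (simp add: dist power2_norm_eq_inner inner_vec_def[of x0])
  then show ?thesis
    by (rule power_less_imp_less_base) simp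
qed

theorem theorem7:
  fixes E :: "'n::finite set set"
    and R\<^sub>0 :: "'n \<Rightarrow> real^3^3"
    and D :: "real set"
    and x :: "real \<Rightarrow> real^3^'n"
  assumes graph: "undirected_graph E"
    and conn: "connected_graph E"
    and rot: "\<And>i. R\<^sub>0 i \<in> SO3"
    and near: "(\<Sum>i\<in>UNIV. (so3_dist (mat 1) (R\<^sub>0 i))\<^sup>2) < pi\<^sup>2"
    and sol: "maximal_filippov_solution (closed_loop E) D x"
    and init: "\<And>i. hat (x 0 $ i) = so3_log (R\<^sub>0 i)"
  shows "D = {0..} \<and>
    (\<exists>tstar>0. \<exists>xbar::real^3.
       (x \<longlongrightarrow> (\<chi> i. xbar)) (at tstar) \<and> (\<forall>t\<ge>tstar. x t = (\<chi> i. xbar)))"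
proof
  have x0: "norm (x 0) < pi"
    using initial_norm_less_pi[OF near init] .
  show D: "D = {0..}"
    by (rule maximal_solution_domain[OF graph sol x0])
  have sol_T: "filippov_solution (closed_loop E) T x" if "0 \<le> T" for T
  proof -
    have "filippov_solution (closed_loop E) (T + 1) x"
      using sol that unfolding maximal_filippov_solution_def filippov_solution_on_def D by auto
    then show ?thesis
      by (rule filippov_solution_subinterval) simp
  qed
  obtain M where M: "0 \<le> M" "\<forall>z \<omega>. norm z \<le> norm (x 0) \<longrightarrow> descent E z \<omega> \<longrightarrow>
       norm (\<chi> i. transition_matrix (z $ i) *v \<omega> $ i) \<le> M"
    using closed_loop_velocity_bound[OF x0, of E] by blast
  have confined: "confined_solution E (norm (x 0)) a b x" if "0 \<le> a" "a \<le> b" for a b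
  proof -
    have "norm (x t) \<le> norm (x 0)" if "t \<in> {0..b}" for t
      using that by (intro filippov_solution_norm_le[OF sol_T x0]) auto
    then have "confined_solution E (norm (x 0)) 0 b x"
      using that M by (intro confined_solutionI(1)[OF sol_T x0]) auto
    then show ?thesis
      by (rule confined_solution_subinterval) (use that in auto)
  qed
  obtain \<gamma> where \<gamma>: "0 < \<gamma>"
    "\<And>y w. norm y \<le> norm (x 0) \<Longrightarrow> \<gamma> * (norm w)\<^sup>2 \<le> w \<bullet> (transition_matrix y *v w)"
    using transition_matrix_coercive[OF x0] by blast
  obtain \<kappa> where \<kappa>: "0 < \<kappa>" "\<And>z \<omega>. descent E z \<omega> \<Longrightarrow> 0 < disagreement E z \<Longrightarrow> \<kappa> \<le> norm \<omega>"
    using descent_norm_bounded_below[OF conn] by blast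
  have mono: "disagreement E (x b) \<le> disagreement E (x a)" if "0 \<le> a" "a \<le> b" for a b
    using confined_solution_disagreement_rate[OF confined[OF that] that(2) \<gamma>(2), of 0] \<gamma>(1) by simp
  have rate: "disagreement E (x b) \<le> disagreement E (x 0) - (\<gamma> * \<kappa>\<^sup>2) * b"
    if "0 \<le> b" "0 < disagreement E (x b)" for b
  proof -
    have "0 < disagreement E (x t)" if "t \<in> {0..b}" for t
      using mono[of t b] that \<open>0 < disagreement E (x b)\<close> by simp
    then have "disagreement E (x b) - disagreement E (x 0) \<le> - (\<gamma> * \<kappa>\<^sup>2) * (b - 0)"
      using \<gamma>(1) \<kappa> \<open>0 \<le> b\<close>
      by (intro confined_solution_disagreement_rate[OF confined _ \<gamma>(2)]) auto
    then show ?thesis by simp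
  qed
  \<comment> \<open>at this time a disagreement decreasing at rate \<open>\<gamma> *
    \<kappa>\<^sup>2\<close> must have vanished\<close>
  define T where "T = disagreement E (x 0) / (\<gamma> * \<kappa>\<^sup>2)"
  have k: "0 < \<gamma> * \<kappa>\<^sup>2"
    using \<gamma>(1) \<kappa>(1) by simp
  have "0 \<le> T"
    using k disagreement_nonneg[of E "x 0"] by (simp add: T_def)
  have zero: "disagreement E (x t) = 0" if "T \<le> t" for t
  proof (rule ccontr)
    assume "disagreement E (x t) \<noteq> 0"
    then have pos: "0 < disagreement E (x t)"
      using disagreement_nonneg[of E "x t"] by simp
    have "disagreement E (x 0) \<le> (\<gamma> * \<kappa>\<^sup>2) * t"
      using that k unfolding T_def by (simp add: pos_divide_le_eq mult.commute)
    then show False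
      using rate[OF _ pos] \<open>0 \<le> T\<close> that pos by simp
  qed
  define xbar where "xbar = x T $ undefined"
  have const: "x t = (\<chi> i. xbar)" if "T \<le> t" for t
  proof -
    have "x t = x T"
      using \<open>0 \<le> T\<close> that zero
      by (intro confined_solution_constant_after_consensus[OF confined _ conn]) auto
    also have "\<dots> = (\<chi> i. xbar)"
      unfolding xbar_def by (rule disagreement_zero_imp_diagonal[OF conn zero]) simp
    finally show ?thesis .
  qed
  show "\<exists>tstar>0. \<exists>xbar::real^3.
       (x \<longlongrightarrow> (\<chi> i. xbar)) (at tstar) \<and> (\<forall>t\<ge>tstar. x t = (\<chi> i. xbar))"
  \<comment> \<open>near \<open>T + 1\<close> the solution is constant on both sides, and this time
    is positive even if \<open>T = 0\<close>\<close>
  proof (intro exI[of _ "T + 1"] exI[of _ xbar] conjI allI impI)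
    have "\<forall>\<^sub>F t in at (T + 1). x t = (\<chi> i. xbar)"
      unfolding eventually_at by (intro exI[of _ 1]) (auto intro!: const simp: dist_real_def)
    then show "(x \<longlongrightarrow> (\<chi> i. xbar)) (at (T + 1))"
      by (rule tendsto_eventually)
  qed (use \<open>0 \<le> T\<close> const in auto)
qed

end
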